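(* Let $\lambda\ge 1$, $\mu\ge 0$, $\delta\ge 1$ and $t\in(1/2,1]$. Let $f(z)=z+\sum_{n\ge2}a_nz^n$ be analytic in $\mathbb{U}$ and let $h_\delta=f*f_\delta$. Suppose $h_\delta\in\sigma$ and $h_\delta\in\mathcal{N}_\sigma^{\mu,\delta}(\lambda,t)$. Put $$\Omega=18(2\delta^2+1)^2(\lambda+\mu)^3U_3(t)-U_1^3(t)(3\lambda+\mu)\Big(3(2\delta^2+1)^2(\mu^2+3\mu-4)+54\delta(\delta^3+2\delta)\Big),$$ $$\begin{aligned}\chi_1={}&(2\lambda+\mu)^2U_1(t)|\Omega|+18(\lambda+\mu)^3\Big(3\delta(\delta^3+2\delta)(\lambda+\mu)(3\lambda+\mu)-(2\delta^2+1)^2(2\lambda+\mu)^2\Big)U_1^2(t)\\&-9(\lambda+\mu)^2(2\lambda+\mu)U_1(t)\Big((3\lambda+\mu)(8\delta^4-4\delta^2+5)U_1^2(t)+4(2\delta^2+1)^2(2\lambda+\mu)(\lambda+\mu)U_2(t)\Big),\end{aligned}$$ $$\begin{aligned}\chi_2={}&\Big[(2\lambda+\mu)(3\lambda+\mu)(8\delta^4-4\delta^2+5)U_1^3(t)+4(2\delta^2+1)^2(\lambda+\mu)(2\lambda+\mu)^2U_1(t)U_2(t)\\&+(\lambda+\mu)U_1^2(t)\big(2(2\delta^2+1)^2(2\lambda+\mu)^2-12\delta(\delta^3+2\delta)(\lambda+\mu)(3\lambda+\mu)\big)\Big](\lambda+\mu)^2,\end{aligned}$$ $$\varphi(2^-,t)=\frac{9U_1^2(t)}{(2\delta^2+1)^2(2\lambda+\mu)^2}+\frac{\chi_1+9\chi_2}{6\delta(\delta^3+2\delta)(2\delta^2+1)^2(3\lambda+\mu)(2\lambda+\mu)^2(\lambda+\mu)^4},$$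 and, when $\chi_1\neq0$ and $\chi_2/\chi_1<0$, with $c_0=\sqrt{-18\chi_2/\chi_1}$, $$\varphi(c_0,t)=\frac{9U_1^2(t)}{(2\delta^2+1)^2(2\lambda+\mu)^2}-\frac{27\chi_2^2}{8\chi_1\,\delta(\delta^3+2\delta)(2\delta^2+1)^2(3\lambda+\mu)(2\lambda+\mu)^2(\lambda+\mu)^4}.$$ Then $$|a_2a_4-a_3^2|\le\begin{cases}\varphi(2^-,t), & \chi_1\ge0\text{ and }\chi_2\ge0,\\[2pt] \dfrac{36t^2}{(2\delta^2+1)^2(2\lambda+\mu)^2}, & \chi_1\le0\text{ and }\chi_2\le0,\\[6pt] \max\left\{\dfrac{36t^2}{(2\delta^2+1)^2(2\lambda+\mu)^2},\ \varphi(2^-,t)\right\}, & \chi_1>0\text{ and }\chi_2<0,\\[6pt] \max\{\varphi(c_0,t),\ \varphi(2^-,t)\}, & \chi_1<0\text{ and }\chi_2>0.\end{cases}$$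
   Context: $\mathbb{U}=\{z\in\mathbb{C}:|z|<1\}$. $\mathcal{A}$ is the class of analytic functions on $\mathbb{U}$ of the form $z+\sum_{n\ge2}\alpha_nz^n$. $\sigma$ is the class of bi-univalent functions: those $h\in\mathcal{A}$ that are univalent in $\mathbb{U}$ and whose inverse $h^{-1}$ (defined near $0$, with $h^{-1}(w)=w-\alpha_2w^2+(2\alpha_2^2-\alpha_3)w^3-\cdots$) is also (i.e. extends to be) univalent in $\mathbb{U}$. Subordination: $F\prec G$ in $\mathbb{U}$ means there is an analytic $w:\mathbb{U}\to\mathbb{U}$ with $w(0)=0$ and $F(z)=G(w(z))$ for $z\in\mathbb{U}$. For $\delta>0$, $f_\delta(z)=\int_0^z\left(\frac{1+r}{1-r}\right)^\delta\frac{dr}{1-r^2}=z+\sum_{n\ge2}b_n(\delta)z^n$ (so $b_2(\delta)=\delta$, $b_3(\delta)=\frac{2\delta^2+1}{3}$). For $f(z)=z+\sum_{n\ge2}a_nz^n\in\mathcal{A}$, $h_\delta=f*f_\delta$ is the Hadamard product $h_\delta(z)=z+\sum_{n\ge2}a_nb_n(\delta)z^n$. $U_n$ are the Chebyshev polynomials of the second kind: $U_1(t)=2t$, $U_2(t)=4t^2-1$, $U_3(t)=8t^3-4t$; and $G(z,t)=\frac{1}{1-2tz+z^2}=1+U_1(t)z+U_2(t)z^2+U_3(t)z^3+\cdots$. For $\lambda\ge1$, $\mu\ge0$, $\delta\ge1$, $t\in(1/2,1]$, the function $h_\delta\in\sigma$ belongs to $\mathcal{N}_\sigma^{\mu,\delta}(\lambda,t)$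 if, with $k_\delta=h_\delta^{-1}$, $$(1-\lambda)\left(\frac{h_\delta(z)}{z}\right)^{\mu}+\lambda h_\delta'(z)\left(\frac{h_\delta(z)}{z}\right)^{\mu-1}\prec G(z,t),\qquad (1-\lambda)\left(\frac{k_\delta(w)}{w}\right)^{\mu}+\lambda k_\delta'(w)\left(\frac{k_\delta(w)}{w}\right)^{\mu-1}\prec G(w,t)$$ for $z,w\in\mathbb{U}$ (powers are the analytic branches equal to $1$ at the origin). *)

theory Defs
  imports "HOL-Complex_Analysis.Complex_Analysis"
begin

abbreviation unit_disc :: "complex set" where
  "unit_disc \<equiv> ball 0 1"

definition taylor_coeff :: "(complex \<Rightarrow> complex) \<Rightarrow> nat \<Rightarrow> complex" where
  "taylor_coeff f n = fps_nth (fps_expansion f 0) n"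

definition class_A :: "(complex \<Rightarrow> complex) set" where
  "class_A = {f. f holomorphic_on unit_disc \<and> f 0 = 0 \<and> deriv f 0 = 1}"

definition subordinate :: "(complex \<Rightarrow> complex) \<Rightarrow> (complex \<Rightarrow> complex) \<Rightarrow> bool" where
  "subordinate F G \<longleftrightarrow>
     (\<exists>w. w holomorphic_on unit_disc \<and> w \<in> unit_disc \<rightarrow> unit_disc \<and> w 0 = 0 \<and>
          (\<forall>z\<in>unit_disc. F z = G (w z)))"

(* The germ at 0 of the inverse of h is the germ of inv_into unit_disc h; k is the
   univalent extension of that germ to the whole disc.  By the identity theorem k is
   unique on the disc. *)
definition univalent_inverse :: "(complex \<Rightarrow> complex) \<Rightarrow> (complex \<Rightarrow> complex) \<Rightarrow> bool" where
  "univalent_inverse h k \<longleftrightarrow>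
     k holomorphic_on unit_disc \<and> inj_on k unit_disc \<and>
     (\<forall>\<^sub>F w in nhds 0. k w = inv_into unit_disc h w)"

definition bi_univalent :: "(complex \<Rightarrow> complex) set" where
  "bi_univalent = {h \<in> class_A. inj_on h unit_disc \<and> (\<exists>k. univalent_inverse h k)}"

(* (1+r)/(1-r) lies in the right half-plane for r in the disc, so the principal branch
   used by powr is holomorphic along the path of integration. *)
definition f_delta :: "real \<Rightarrow> complex \<Rightarrow> complex" where
  "f_delta \<delta> z =
     contour_integral (linepath 0 z)
       (\<lambda>r. ((1 + r) / (1 - r)) powr (complex_of_real \<delta>) / (1 - r\<^sup>2))"

definition hadamard_product ::
    "(complex \<Rightarrow> complex) \<Rightarrow> (complex \<Rightarrow> complex) \<Rightarrow> complex \<Rightarrow> complex" where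
  "hadamard_product f g z = (\<Sum>n. taylor_coeff f n * taylor_coeff g n * z ^ n)"

fun cheb_U :: "nat \<Rightarrow> real \<Rightarrow> real" where
  "cheb_U 0 t = 1"
| "cheb_U (Suc 0) t = 2 * t"
| "cheb_U (Suc (Suc n)) t = 2 * t * cheb_U (Suc n) t - cheb_U n t"

lemma cheb_U_1: "cheb_U 1 t = 2 * t"
  and cheb_U_2: "cheb_U 2 t = 4 * t\<^sup>2 - 1"
  and cheb_U_3: "cheb_U 3 t = 8 * t ^ 3 - 4 * t"
  by (simp_all add: eval_nat_numeral algebra_simps)

definition cheb_gen :: "real \<Rightarrow> complex \<Rightarrow> complex" where
  "cheb_gen t z = 1 / (1 - 2 * complex_of_real t * z + z\<^sup>2)"

(* h(z)/z with its removable singularity at 0 filled in *)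
definition quot_id :: "(complex \<Rightarrow> complex) \<Rightarrow> complex \<Rightarrow> complex" where
  "quot_id h z = (if z = 0 then deriv h 0 else h z / z)"

(* For g holomorphic and zero-free on the disc with g 0 = 1 there is, on the disc, exactly
   one holomorphic logarithm L of g with L 0 = 0; exp (s * L) is then the branch of the
   power of g that equals 1 at 0.  The principal powr is not suitable here, since g may
   cross its branch cut. *)
definition branch_power :: "(complex \<Rightarrow> complex) \<Rightarrow> real \<Rightarrow> complex \<Rightarrow> complex" where
  "branch_power g s z =
     (let L = (SOME L. L holomorphic_on unit_disc \<and> L 0 = 0 \<and>
                       (\<forall>u\<in>unit_disc. exp (L u) = g u))
      in exp (complex_of_real s * L z))"

definition N_op :: "real \<Rightarrow> real \<Rightarrow> (complex \<Rightarrow> complex) \<Rightarrow> complex \<Rightarrow> complex" where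
  "N_op \<mu> lam h z =
     (1 - complex_of_real lam) * branch_power (quot_id h) \<mu> z
     + complex_of_real lam * deriv h z * branch_power (quot_id h) (\<mu> - 1) z"

definition N_class :: "real \<Rightarrow> real \<Rightarrow> real \<Rightarrow> real \<Rightarrow> (complex \<Rightarrow> complex) set" where
  "N_class \<mu> \<delta> lam t =
     {h \<in> bi_univalent.
        (\<exists>f\<in>class_A. h = hadamard_product f (f_delta \<delta>)) \<and>
        (\<exists>k. univalent_inverse h k \<and>
             subordinate (N_op \<mu> lam h) (cheb_gen t) \<and>
             subordinate (N_op \<mu> lam k) (cheb_gen t))}"

definition Om :: "real \<Rightarrow> real \<Rightarrow> real \<Rightarrow> real \<Rightarrow> real" where
  "Om lam \<mu> \<delta> t =
     18 * (2 * \<delta>\<^sup>2 + 1)\<^sup>2 * (lam + \<mu>) ^ 3 * cheb_U 3 t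
     - (cheb_U 1 t) ^ 3 * (3 * lam + \<mu>)
       * (3 * (2 * \<delta>\<^sup>2 + 1)\<^sup>2 * (\<mu>\<^sup>2 + 3 * \<mu> - 4) + 54 * \<delta> * (\<delta> ^ 3 + 2 * \<delta>))"

definition chi1 :: "real \<Rightarrow> real \<Rightarrow> real \<Rightarrow> real \<Rightarrow> real" where
  "chi1 lam \<mu> \<delta> t =
     (2 * lam + \<mu>)\<^sup>2 * cheb_U 1 t * \<bar>Om lam \<mu> \<delta> t\<bar>
     + 18 * (lam + \<mu>) ^ 3
       * (3 * \<delta> * (\<delta> ^ 3 + 2 * \<delta>) * (lam + \<mu>) * (3 * lam + \<mu>)
          - (2 * \<delta>\<^sup>2 + 1)\<^sup>2 * (2 * lam + \<mu>)\<^sup>2)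
       * (cheb_U 1 t)\<^sup>2
     - 9 * (lam + \<mu>)\<^sup>2 * (2 * lam + \<mu>) * cheb_U 1 t
       * ((3 * lam + \<mu>) * (8 * \<delta> ^ 4 - 4 * \<delta>\<^sup>2 + 5) * (cheb_U 1 t)\<^sup>2
          + 4 * (2 * \<delta>\<^sup>2 + 1)\<^sup>2 * (2 * lam + \<mu>) * (lam + \<mu>) * cheb_U 2 t)"

definition chi2 :: "real \<Rightarrow> real \<Rightarrow> real \<Rightarrow> real \<Rightarrow> real" where
  "chi2 lam \<mu> \<delta> t =
     ((2 * lam + \<mu>) * (3 * lam + \<mu>) * (8 * \<delta> ^ 4 - 4 * \<delta>\<^sup>2 + 5) * (cheb_U 1 t) ^ 3
      + 4 * (2 * \<delta>\<^sup>2 + 1)\<^sup>2 * (lam + \<mu>) * (2 * lam + \<mu>)\<^sup>2 * cheb_U 1 t * cheb_U 2 t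
      + (lam + \<mu>) * (cheb_U 1 t)\<^sup>2
        * (2 * (2 * \<delta>\<^sup>2 + 1)\<^sup>2 * (2 * lam + \<mu>)\<^sup>2
           - 12 * \<delta> * (\<delta> ^ 3 + 2 * \<delta>) * (lam + \<mu>) * (3 * lam + \<mu>)))
     * (lam + \<mu>)\<^sup>2"

(* the value phi(2^-, t) *)
definition phi_2 :: "real \<Rightarrow> real \<Rightarrow> real \<Rightarrow> real \<Rightarrow> real" where
  "phi_2 lam \<mu> \<delta> t =
     9 * (cheb_U 1 t)\<^sup>2 / ((2 * \<delta>\<^sup>2 + 1)\<^sup>2 * (2 * lam + \<mu>)\<^sup>2)
     + (chi1 lam \<mu> \<delta> t + 9 * chi2 lam \<mu> \<delta> t)
       / (6 * \<delta> * (\<delta> ^ 3 + 2 * \<delta>) * (2 * \<delta>\<^sup>2 + 1)\<^sup>2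
          * (3 * lam + \<mu>) * (2 * lam + \<mu>)\<^sup>2 * (lam + \<mu>) ^ 4)"

(* the value phi(c0, t), where c0 = sqrt (- 18 * chi2 / chi1); it is meaningful, and used,
   only when chi1 and chi2 have opposite signs *)
definition phi_c0 :: "real \<Rightarrow> real \<Rightarrow> real \<Rightarrow> real \<Rightarrow> real" where
  "phi_c0 lam \<mu> \<delta> t =
     9 * (cheb_U 1 t)\<^sup>2 / ((2 * \<delta>\<^sup>2 + 1)\<^sup>2 * (2 * lam + \<mu>)\<^sup>2)
     - 27 * (chi2 lam \<mu> \<delta> t)\<^sup>2
       / (8 * chi1 lam \<mu> \<delta> t * \<delta> * (\<delta> ^ 3 + 2 * \<delta>) * (2 * \<delta>\<^sup>2 + 1)\<^sup>2
          * (3 * lam + \<mu>) * (2 * lam + \<mu>)\<^sup>2 * (lam + \<mu>) ^ 4)"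

end

theory Submission
  imports Defs
begin

text \<open>
  Let $w$ and $v$ be the Schwarz functions of the two subordinations, with Taylor coefficients
  $d_n$ and $e_n$. Comparing coefficients gives $e_1 = -d_1$ and expresses $a_2 a_4 - a_3^2$ as a
  combination of $d_1^4$, $d_1^2 (d_2 - e_2)$, $d_1^2 (d_2 + e_2)$, $d_1 (d_3 - e_3)$ and
  $(d_2 - e_2)^2$. Put $r = |d_1|$. Two steps of the Schur algorithm give
  $|d_2| = (1 - r^2) p$ and $|d_3| \<le> (1 - r^2) (1 - p^2 + r p^2)$ with $0 \<le> p \<le> 1$, and
  likewise for $v$ with some $q$. The resulting bound is largest at $p = q = 1$, because the
  weight of the $d_3$ term is at most four times that of $(d_2 - e_2)^2$; there it is a quadratic
  polynomial in $r^2$ whose coefficients are multiples of $\<chi>_1$ and $\<chi>_2$.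
\<close>

section \<open>Low-order coefficients of power series\<close>

text \<open>The obstacle is the term d_1 (d_3 - e_3). If |d_3| and |e_3| were bounded by 1 - r^2
  alone, it would contribute a multiple of r (1 - r^2), linear in r near 0, and the estimate would
  exceed its value at r = 0 even when \<open>chi1\<close> and \<open>chi2\<close> are both
  nonpositive. Hence p and q are retained: a large d_3 forces a small d_2, and what is then lost in
  (d_2 - e_2)^2 outweighs the gain. The constants of the statement come from the parameter c = 2r in
  [0,2], while the proof works with x = r^2 = c^2/4. So phi(2^-) is the value at x = 1, which is the
  absolute weight of d_1^4, and \<open>c0\<close> marks the vertex of the quadratic. Branches of
  powers, the contour integral, the quotient \<open>cheb_gen\<close> and the inverse function are
  each traded for a polynomial or differential relation between formal power series; only a few
  coefficients of such a relation are ever read off.\<close>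

lemma fps_mult_nth_low:
  fixes F G :: "'a::comm_ring_1 fps"
  shows "fps_nth (F * G) 1 = fps_nth F 0 * fps_nth G 1 + fps_nth F 1 * fps_nth G 0"
    and "fps_nth (F * G) 2 = fps_nth F 0 * fps_nth G 2 + fps_nth F 1 * fps_nth G 1
           + fps_nth F 2 * fps_nth G 0"
    and "fps_nth (F * G) 3 = fps_nth F 0 * fps_nth G 3 + fps_nth F 1 * fps_nth G 2
           + fps_nth F 2 * fps_nth G 1 + fps_nth F 3 * fps_nth G 0"
    and "fps_nth (F * G) 4 = fps_nth F 0 * fps_nth G 4 + fps_nth F 1 * fps_nth G 3
           + fps_nth F 2 * fps_nth G 2 + fps_nth F 3 * fps_nth G 1 + fps_nth F 4 * fps_nth G 0"
  by (simp_all add: fps_mult_nth eval_nat_numeral sum.atLeast0_atMost_Suc)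

lemma fps_deriv_nth_low:
  fixes F :: "'a::comm_ring_1 fps"
  shows "fps_nth (fps_deriv F) 0 = fps_nth F 1"
    and "fps_nth (fps_deriv F) (Suc 0) = 2 * fps_nth F 2"
    and "fps_nth (fps_deriv F) 2 = 3 * fps_nth F 3"
    and "fps_nth (fps_deriv F) 3 = 4 * fps_nth F 4"
  by (simp_all add: eval_nat_numeral algebra_simps)

lemma has_fps_expansion_eventually_eq:
  fixes F G :: "complex fps"
  assumes "f has_fps_expansion F" "g has_fps_expansion G" "eventually (\<lambda>z. f z = g z) (nhds 0)"
  shows "F = G"
  using assms has_fps_expansion_cong[OF assms(3) refl, of F] fps_expansion_unique_complex by blast

lemma has_fps_expansion_eq_on_disc:
  fixes F G :: "complex fps"
  assumes "f has_fps_expansion F" "g has_fps_expansion G" "\<And>z. z \<in> unit_disc \<Longrightarrow> f z = g z"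
  shows "F = G"
proof (rule has_fps_expansion_eventually_eq[OF assms(1,2)])
  have "eventually (\<lambda>z. z \<in> unit_disc) (nhds (0::complex))"
    by (intro eventually_nhds_in_open) auto
  then show "eventually (\<lambda>z. f z = g z) (nhds 0)"
    by eventually_elim (rule assms(3))
qed

lemma holomorphic_on_disc_has_fps_expansion:
  assumes "f holomorphic_on unit_disc"
  shows "f has_fps_expansion fps_expansion f 0"
  by (rule has_fps_expansion_fps_expansion[of unit_disc]) (use assms in auto)

lemma fps_nth_0_1_has_fps_expansion:
  fixes F :: "complex fps"
  assumes "f has_fps_expansion F"
  shows "fps_nth F 0 = f 0" "fps_nth F 1 = deriv f 0"
  using fps_nth_fps_expansion[OF assms, of 0] fps_nth_fps_expansion[OF assms, of 1] by simp_all

section \<open>Coefficients of Schwarz functions\<close>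

text \<open>Here \<psi> is w(z)/z followed by the disc automorphism that sends w'(0) to 0. The
  relation is stated without its denominator so that it also covers a rotation w, where w(z)/z is a
  constant of modulus 1 and no such automorphism exists.\<close>

lemma Schur_step:
  assumes w: "w holomorphic_on unit_disc" "w \<in> unit_disc \<rightarrow> unit_disc" "w 0 = 0"
  obtains \<psi> where "\<psi> holomorphic_on unit_disc" "\<psi> \<in> unit_disc \<rightarrow> unit_disc" "\<psi> 0 = 0"
    "\<And>z. z \<in> unit_disc \<Longrightarrow> w z * (1 + cnj (deriv w 0) * \<psi> z) = z * (\<psi> z + deriv w 0)"
proof -
  let ?d = "deriv w 0"
  have lt1: "norm (w z) < 1" if "norm z < 1" for z
    using w(2) that by (auto simp: Pi_def)
  have S1: "norm (w z) \<le> norm z" if "norm z < 1" for z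
    using Schwarz_Lemma(1)[OF w(1,3) lt1 that] .
  have S2: "norm ?d \<le> 1"
    using Schwarz_Lemma(2)[OF w(1,3) lt1, of 0] by simp
  have S3: "norm ?d = 1 \<and> (\<forall>z. norm z < 1 \<longrightarrow> w z = ?d * z)"
    if extremal: "(\<exists>z. norm z < 1 \<and> z \<noteq> 0 \<and> norm (w z) = norm z) \<or> norm ?d = 1"
  proof -
    obtain \<alpha> where \<alpha>: "\<forall>z. norm z < 1 \<longrightarrow> w z = \<alpha> * z" "norm \<alpha> = 1"
      using Schwarz_Lemma(3)[OF w(1,3) lt1 _ extremal, of 0] by auto
    have "(w has_field_derivative \<alpha>) (at 0)"
    proof (rule has_field_derivative_transform_within_open[where S = unit_disc])
      show "((\<lambda>z. \<alpha> * z) has_field_derivative \<alpha>) (at 0)"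
        by (auto intro!: derivative_eq_intros)
    qed (use \<alpha> in auto)
    then have "?d = \<alpha>"
      by (rule DERIV_imp_deriv)
    then show ?thesis
      using \<alpha> by simp
  qed
  show thesis
  proof (cases "norm ?d = 1")
    case True
    then have "\<forall>z. norm z < 1 \<longrightarrow> w z = ?d * z"
      using S3 by metis
    \<comment> \<open>For a rotation the cleared relation reads w(z) = z w'(0), so the zero function
      serves.\<close>
    then show thesis
      by (intro that[of "\<lambda>_. 0"]) simp_all
  next
    case False
    obtain \<phi> where \<phi>: "\<phi> holomorphic_on unit_disc" "\<And>z. norm z < 1 \<Longrightarrow> w z = z * \<phi> z" "?d = \<phi> 0"
      by (rule Schwarz3[OF w(1,3)]) blast
    have d: "norm ?d < 1"
      using False S2 by simp
    have *: "norm (\<phi> z) < 1" if "norm z < 1" for z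
    proof (cases "z = 0")
      case True
      then show ?thesis using d \<phi>(3) by simp
    next
      case nz: False
      \<comment> \<open>Equality at a single nonzero point would make w a rotation, contrary to
        |w'(0)| < 1.\<close>
      have "norm (w z) \<noteq> norm z"
        using S3 nz that False by metis
      then have "norm z * norm (\<phi> z) < norm z * 1"
        using S1[OF that] \<phi>(2)[OF that] by (simp add: norm_mult order_less_le)
      then show ?thesis using nz by simp
    qed
    define \<psi> where "\<psi> = (\<lambda>z. Moebius_function 0 ?d (\<phi> z))"
    show thesis
    proof (rule that[of \<psi>])
      have "Moebius_function 0 ?d \<circ> \<phi> holomorphic_on unit_disc"
        by (rule holomorphic_on_compose_gen[OF \<phi>(1) Moebius_function_holomorphic[OF d]]) (use * in auto)
      then show "\<psi> holomorphic_on unit_disc"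
        by (simp add: \<psi>_def o_def)
      show "\<psi> \<in> unit_disc \<rightarrow> unit_disc"
        using Moebius_function_norm_lt_1[OF d *] by (auto simp: \<psi>_def)
      show "\<psi> 0 = 0"
        by (simp add: \<psi>_def \<phi>(3) Moebius_function_eq_zero)
      fix z assume "z \<in> unit_disc"
      then have z: "norm z < 1" by simp
      have "norm (cnj ?d * \<phi> z) < 1"
        using d *[OF z] norm_mult_less[of "cnj ?d" 1 "\<phi> z" 1] by simp
      then have ne: "1 - cnj ?d * \<phi> z \<noteq> 0"
        by auto
      have "\<psi> z * (1 - cnj ?d * \<phi> z) = \<phi> z - ?d"
        using ne by (simp add: \<psi>_def Moebius_function_simple)
      then have "\<phi> z * (1 + cnj ?d * \<psi> z) = \<psi> z + ?d"
        by (simp add: algebra_simps)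
      then show "w z * (1 + cnj ?d * \<psi> z) = z * (\<psi> z + ?d)"
        using \<phi>(2)[OF z] by simp
    qed
  qed
qed

lemma Schur_step_fps:
  fixes w :: "complex \<Rightarrow> complex" and W :: "complex fps"
  assumes w: "w holomorphic_on unit_disc" "w \<in> unit_disc \<rightarrow> unit_disc" "w 0 = 0"
    and W: "w has_fps_expansion W"
  obtains \<psi> :: "complex \<Rightarrow> complex" and \<Psi> where "\<psi> holomorphic_on unit_disc" "\<psi> \<in> unit_disc \<rightarrow> unit_disc" "\<psi> 0 = 0"
    "\<psi> has_fps_expansion \<Psi>"
    "fps_nth W 2 = (1 - (norm (fps_nth W 1))\<^sup>2) * fps_nth \<Psi> 1"
    "fps_nth W 3 = (1 - (norm (fps_nth W 1))\<^sup>2) * (fps_nth \<Psi> 2 - cnj (fps_nth W 1) * (fps_nth \<Psi> 1)\<^sup>2)"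
proof -
  obtain \<psi> where \<psi>: "\<psi> holomorphic_on unit_disc" "\<psi> \<in> unit_disc \<rightarrow> unit_disc" "\<psi> 0 = 0"
    and eq: "\<And>z. z \<in> unit_disc \<Longrightarrow> w z * (1 + cnj (deriv w 0) * \<psi> z) = z * (\<psi> z + deriv w 0)"
    using Schur_step[OF w] by metis
  define \<Psi> where "\<Psi> = fps_expansion \<psi> 0"
  have \<Psi>: "\<psi> has_fps_expansion \<Psi>"
    unfolding \<Psi>_def by (rule holomorphic_on_disc_has_fps_expansion[OF \<psi>(1)])
  let ?d = "deriv w 0"
  have E: "W * (1 + fps_const (cnj ?d) * \<Psi>) = fps_X * (\<Psi> + fps_const ?d)"
    by (rule has_fps_expansion_eq_on_disc[OF _ _ eq]) (auto intro!: fps_expansion_intros W \<Psi>)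
  have [simp]: "fps_nth W 0 = 0" "fps_nth \<Psi> 0 = 0" and d: "?d = fps_nth W 1"
    using fps_nth_0_1_has_fps_expansion[OF W] fps_nth_0_1_has_fps_expansion[OF \<Psi>] w \<psi> by simp_all
  have dd: "fps_nth W 1 * cnj (fps_nth W 1) = complex_of_real ((norm (fps_nth W 1))\<^sup>2)"
    by (metis complex_norm_square)
  have 2: "fps_nth W 2 + fps_nth W 1 * cnj (fps_nth W 1) * fps_nth \<Psi> 1 = fps_nth \<Psi> 1"
    using arg_cong[OF E, of "\<lambda>F. fps_nth F 2"] d by (simp add: fps_mult_nth_low algebra_simps)
  then have c2: "fps_nth W 2 = (1 - (norm (fps_nth W 1))\<^sup>2) * fps_nth \<Psi> 1"
    unfolding dd by (simp add: algebra_simps)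
  have "fps_nth W 3 + cnj (fps_nth W 1) * fps_nth W 2 * fps_nth \<Psi> 1
      + fps_nth W 1 * cnj (fps_nth W 1) * fps_nth \<Psi> 2 = fps_nth \<Psi> 2"
    using arg_cong[OF E, of "\<lambda>F. fps_nth F 3"] d by (simp add: fps_mult_nth_low algebra_simps)
  then have c3: "fps_nth W 3 = (1 - (norm (fps_nth W 1))\<^sup>2) * (fps_nth \<Psi> 2 - cnj (fps_nth W 1) * (fps_nth \<Psi> 1)\<^sup>2)"
    unfolding dd c2 by (simp add: algebra_simps power2_eq_square)
  show thesis
    by (rule that[OF \<psi> \<Psi> c2 c3])
qed

lemma Schwarz_coeff_1:
  assumes w: "w holomorphic_on unit_disc" "w \<in> unit_disc \<rightarrow> unit_disc" "w 0 = 0"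
    and W: "w has_fps_expansion W"
  shows "norm (fps_nth W 1) \<le> 1"
  using Schwarz_Lemma'[OF w(1,3)] w(2) fps_nth_0_1_has_fps_expansion[OF W] by (auto simp: Pi_def)

lemma Schwarz_coeff_2:
  assumes w: "w holomorphic_on unit_disc" "w \<in> unit_disc \<rightarrow> unit_disc" "w 0 = 0"
    and W: "w has_fps_expansion W"
  shows "norm (fps_nth W 2) \<le> 1 - (norm (fps_nth W 1))\<^sup>2"
proof -
  obtain \<psi> :: "complex \<Rightarrow> complex" and \<Psi> where \<psi>: "\<psi> holomorphic_on unit_disc" "\<psi> \<in> unit_disc \<rightarrow> unit_disc" "\<psi> 0 = 0"
    "\<psi> has_fps_expansion \<Psi>"
    and 2: "fps_nth W 2 = (1 - (norm (fps_nth W 1))\<^sup>2) * fps_nth \<Psi> 1"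
    by (rule Schur_step_fps[OF assms])
  have 1: "0 \<le> 1 - (norm (fps_nth W 1))\<^sup>2"
    using Schwarz_coeff_1[OF assms] by (simp add: power_le_one)
  have "norm (fps_nth W 2) = \<bar>1 - (norm (fps_nth W 1))\<^sup>2\<bar> * norm (fps_nth \<Psi> 1)"
    unfolding 2 norm_mult by (metis norm_of_real of_real_1 of_real_diff)
  then show ?thesis
    using 1 Schwarz_coeff_1[OF \<psi>] by (simp add: mult_left_le)
qed

text \<open>The value p is |\<psi>'(0)| for the function \<psi> of one Schur step. The second-order
  bound applied to \<psi> itself is the second step. The same p occurs in both conclusions, which is
  what links the sizes of the second and third coefficients.\<close>

lemma Schwarz_coeff_3:
  assumes w: "w holomorphic_on unit_disc" "w \<in> unit_disc \<rightarrow> unit_disc" "w 0 = 0"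
    and W: "w has_fps_expansion W"
  obtains p where "0 \<le> p" "p \<le> 1"
    "norm (fps_nth W 2) = (1 - (norm (fps_nth W 1))\<^sup>2) * p"
    "norm (fps_nth W 3) \<le> (1 - (norm (fps_nth W 1))\<^sup>2) * (1 - p\<^sup>2 + norm (fps_nth W 1) * p\<^sup>2)"
proof -
  obtain \<psi> :: "complex \<Rightarrow> complex" and \<Psi> where \<psi>: "\<psi> holomorphic_on unit_disc" "\<psi> \<in> unit_disc \<rightarrow> unit_disc" "\<psi> 0 = 0"
    "\<psi> has_fps_expansion \<Psi>"
    and 2: "fps_nth W 2 = (1 - (norm (fps_nth W 1))\<^sup>2) * fps_nth \<Psi> 1"
    and 3: "fps_nth W 3 = (1 - (norm (fps_nth W 1))\<^sup>2) * (fps_nth \<Psi> 2 - cnj (fps_nth W 1) * (fps_nth \<Psi> 1)\<^sup>2)"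
    by (rule Schur_step_fps[OF assms])
  have 1: "0 \<le> 1 - (norm (fps_nth W 1))\<^sup>2"
    using Schwarz_coeff_1[OF assms] by (simp add: power_le_one)
  then have n1: "norm (1 - complex_of_real ((norm (fps_nth W 1))\<^sup>2)) = 1 - (norm (fps_nth W 1))\<^sup>2"
    by (metis abs_of_nonneg norm_of_real of_real_1 of_real_diff)
  have "norm (fps_nth \<Psi> 2 - cnj (fps_nth W 1) * (fps_nth \<Psi> 1)\<^sup>2)
      \<le> norm (fps_nth \<Psi> 2) + norm (cnj (fps_nth W 1) * (fps_nth \<Psi> 1)\<^sup>2)"
    by (rule norm_triangle_ineq4)
  also have "\<dots> \<le> 1 - (norm (fps_nth \<Psi> 1))\<^sup>2 + norm (fps_nth W 1) * (norm (fps_nth \<Psi> 1))\<^sup>2"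
    using Schwarz_coeff_2[OF \<psi>] by (simp add: norm_mult norm_power)
  finally have le: "norm (fps_nth \<Psi> 2 - cnj (fps_nth W 1) * (fps_nth \<Psi> 1)\<^sup>2) \<le> \<dots>" .
  show thesis
  proof (rule that[of "norm (fps_nth \<Psi> 1)"])
    show "norm (fps_nth W 2) = (1 - (norm (fps_nth W 1))\<^sup>2) * norm (fps_nth \<Psi> 1)"
      unfolding 2 norm_mult using n1 by simp
    show "norm (fps_nth W 3) \<le> (1 - (norm (fps_nth W 1))\<^sup>2)
        * (1 - (norm (fps_nth \<Psi> 1))\<^sup>2 + norm (fps_nth W 1) * (norm (fps_nth \<Psi> 1))\<^sup>2)"
      unfolding 3 norm_mult using n1 1 le by (simp add: mult_left_mono)
  qed (use Schwarz_coeff_1[OF \<psi>] in auto)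
qed

section \<open>Coefficients of the functions in the class\<close>

text \<open>For W = g^s the logarithmic derivative gives W'/W = s g'/g. Multiplied out, this is a
  recursion for the coefficients of W in which the logarithm no longer occurs.\<close>

lemma exp_mult_log_fps:
  assumes g: "g has_fps_expansion G" and L: "L holomorphic_on unit_disc"
    and eq: "\<And>u. u \<in> unit_disc \<Longrightarrow> exp (L u) = g u"
    and W: "(\<lambda>z. exp (s * L z)) has_fps_expansion W"
  shows "G * fps_deriv W = fps_const s * fps_deriv G * W"
proof (rule has_fps_expansion_eq_on_disc)
  show "(\<lambda>z. g z * deriv (\<lambda>z. exp (s * L z)) z) has_fps_expansion G * fps_deriv W"
    by (intro fps_expansion_intros g W)
  show "(\<lambda>z. s * deriv g z * exp (s * L z)) has_fps_expansion fps_const s * fps_deriv G * W"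
    by (intro fps_expansion_intros g W)
  fix z assume z: "z \<in> unit_disc"
  have dL: "(L has_field_derivative deriv L z) (at z)"
    using holomorphic_derivI[OF L open_ball z] .
  have "((\<lambda>z. exp (L z)) has_field_derivative exp (L z) * deriv L z) (at z)"
    by (auto intro!: derivative_eq_intros dL)
  then have "(g has_field_derivative exp (L z) * deriv L z) (at z)"
    by (rule has_field_derivative_transform_within_open[where S = unit_disc]) (use z eq in auto)
  then have 1: "deriv g z = exp (L z) * deriv L z"
    by (rule DERIV_imp_deriv)
  have 2: "deriv (\<lambda>z. exp (s * L z)) z = exp (s * L z) * (s * deriv L z)"
    by (rule DERIV_imp_deriv) (auto intro!: derivative_eq_intros dL)
  show "g z * deriv (\<lambda>z. exp (s * L z)) z = s * deriv g z * exp (s * L z)"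
    unfolding 1 2 using eq[OF z] by simp
qed

lemma branch_power_fps:
  assumes g: "g holomorphic_on unit_disc" "\<And>z. z \<in> unit_disc \<Longrightarrow> g z \<noteq> 0" "g 0 = 1"
    and G: "g has_fps_expansion G"
  obtains W where "branch_power g s has_fps_expansion W" "fps_nth W 0 = 1"
    "G * fps_deriv W = fps_const (of_real s) * fps_deriv G * W"
proof -
  let ?P = "\<lambda>L. L holomorphic_on unit_disc \<and> L 0 = 0 \<and> (\<forall>u\<in>unit_disc. exp (L u) = g u)"
  obtain L0 where L0: "L0 holomorphic_on unit_disc" "\<And>x. x \<in> unit_disc \<Longrightarrow> exp (L0 x) = g x"
    using holomorphic_logarithm_exists[OF convex_ball open_ball g(1,2), of 0] by auto
  have "exp (L0 0) = 1"
    using L0(2)[of 0] g(3) by simp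
  \<comment> \<open>Since exp (L0 0) = 1, subtracting the constant L0 0 normalises the logarithm at
    0 without changing its exponential.\<close>
  then have "?P (\<lambda>z. L0 z - L0 0)"
    using L0 by (auto intro!: holomorphic_intros simp: exp_diff)
  then have "?P (SOME L. ?P L)"
    by (rule someI[where P = ?P])
  moreover define L where "L = (SOME L. ?P L)"
  ultimately have L: "L holomorphic_on unit_disc" "L 0 = 0" "\<And>u. u \<in> unit_disc \<Longrightarrow> exp (L u) = g u"
    by blast+
  have bp: "branch_power g s = (\<lambda>z. exp (of_real s * L z))"
    by (simp add: branch_power_def L_def fun_eq_iff)
  have "(\<lambda>z. exp (of_real s * L z)) holomorphic_on unit_disc"
    by (intro holomorphic_intros L)
  then have W: "(\<lambda>z. exp (of_real s * L z)) has_fps_expansion fps_expansion (\<lambda>z. exp (of_real s * L z)) 0"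
    (is "_ has_fps_expansion ?W")
    by (rule holomorphic_on_disc_has_fps_expansion)
  show thesis
  proof (rule that[of ?W])
    show "fps_nth ?W 0 = 1"
      using fps_nth_0_1_has_fps_expansion(1)[OF W] L(2) by simp
    show "G * fps_deriv ?W = fps_const (of_real s) * fps_deriv G * ?W"
      by (rule exp_mult_log_fps[OF G L(1,3) W])
  qed (use W bp in auto)
qed

lemma fps_power_ode_coeffs:
  fixes G W :: "complex fps"
  assumes ode: "G * fps_deriv W = fps_const s * fps_deriv G * W"
    and [simp]: "fps_nth G 0 = 1" "fps_nth W 0 = 1"
  shows "fps_nth W 1 = s * fps_nth G 1"
    and "fps_nth W 2 = s * fps_nth G 2 + s * (s - 1) / 2 * (fps_nth G 1)\<^sup>2"
    and "fps_nth W 3 = s * fps_nth G 3 + s * (s - 1) * fps_nth G 1 * fps_nth G 2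
           + s * (s - 1) * (s - 2) / 6 * fps_nth G 1 ^ 3"
proof -
  have 1: "fps_nth W 1 = s * fps_nth G 1"
    using arg_cong[OF ode, of "\<lambda>F. fps_nth F 0"] by (simp add: fps_deriv_nth_low del: fps_deriv_nth)
  have 2: "2 * fps_nth W 2 + fps_nth G 1 * fps_nth W 1 = s * (fps_nth G 1 * fps_nth W 1 + 2 * fps_nth G 2)"
    using arg_cong[OF ode, of "\<lambda>F. fps_nth F 1"]
    by (simp add: fps_mult_nth_low fps_deriv_nth_low algebra_simps del: fps_deriv_nth)
  have 3: "3 * fps_nth W 3 + 2 * fps_nth G 1 * fps_nth W 2 + fps_nth G 2 * fps_nth W 1
      = s * (fps_nth G 1 * fps_nth W 2 + 2 * fps_nth G 2 * fps_nth W 1 + 3 * fps_nth G 3)"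
    using arg_cong[OF ode, of "\<lambda>F. fps_nth F 2"]
    by (simp add: fps_mult_nth_low fps_deriv_nth_low algebra_simps del: fps_deriv_nth)
  show "fps_nth W 1 = s * fps_nth G 1"
    by (fact 1)
  show c2: "fps_nth W 2 = s * fps_nth G 2 + s * (s - 1) / 2 * (fps_nth G 1)\<^sup>2"
    using 2 unfolding 1 by (simp add: field_simps power2_eq_square)
  show "fps_nth W 3 = s * fps_nth G 3 + s * (s - 1) * fps_nth G 1 * fps_nth G 2
           + s * (s - 1) * (s - 2) / 6 * fps_nth G 1 ^ 3"
  proof -
    have "2 * fps_nth W 2 = 2 * s * fps_nth G 2 + s * (s - 1) * (fps_nth G 1)\<^sup>2"
      unfolding c2 by (simp add: field_simps)
    then have "6 * fps_nth W 3 = 6 * (s * fps_nth G 3) + 6 * (s * (s - 1) * fps_nth G 1 * fps_nth G 2)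
        + s * (s - 1) * (s - 2) * fps_nth G 1 ^ 3"
      using 1 3 by algebra
    then show ?thesis
      by (simp add: field_simps)
  qed
qed

text \<open>With q = h(z)/z one has h' = q + z q', so the operator equals q^\<mu> + lam z q'
  q^(\<mu>-1), which for \<mu> > 0 is q^\<mu> + (lam/\<mu>) z (q^\<mu>)'. This explains the factors
  n lam + \<mu>. As \<mu> = 0 is allowed, the proof does not divide by \<mu> but expands the two
  powers separately.\<close>

lemma N_op_coeffs:
  fixes h :: "complex \<Rightarrow> complex" and H :: "complex fps"
  assumes h: "h holomorphic_on unit_disc" "inj_on h unit_disc" "h 0 = 0" "deriv h 0 = 1"
    and H: "h has_fps_expansion H"
  obtains N :: "complex fps" where "N_op \<mu> lam h has_fps_expansion N" "fps_nth N 0 = 1"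
    "fps_nth N 1 = (of_real lam + of_real \<mu>) * fps_nth H 2"
    "fps_nth N 2 = (2 * of_real lam + of_real \<mu>) * (fps_nth H 3 + (of_real \<mu> - 1) / 2 * (fps_nth H 2)\<^sup>2)"
    "fps_nth N 3 = (3 * of_real lam + of_real \<mu>) * (fps_nth H 4 + (of_real \<mu> - 1) * fps_nth H 2 * fps_nth H 3
       + (of_real \<mu> - 1) * (of_real \<mu> - 2) / 6 * fps_nth H 2 ^ 3)"
proof -
  have H0: "fps_nth H 0 = 0" "fps_nth H (Suc 0) = 1"
    using fps_nth_0_1_has_fps_expansion[OF H] h by simp_all
  have q: "quot_id h holomorphic_on unit_disc"
    using pole_lemma_open[OF h(1) open_ball, of 0] h(3) unfolding quot_id_def[abs_def]
    by (simp cong: if_cong)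
  have q_nz: "quot_id h z \<noteq> 0" if "z \<in> unit_disc" for z
    using inj_onD[OF h(2), of z 0] that h(3,4) by (auto simp: quot_id_def)
  have q0: "quot_id h 0 = 1"
    using h(4) by (simp add: quot_id_def)
  define Q where "Q = fps_expansion (quot_id h) 0"
  have Q: "quot_id h has_fps_expansion Q"
    unfolding Q_def by (rule holomorphic_on_disc_has_fps_expansion[OF q])
  have HQ: "H = fps_X * Q"
    by (rule has_fps_expansion_eq_on_disc[OF H has_fps_expansion_mult[OF has_fps_expansion_fps_X Q]])
      (simp add: quot_id_def h(3))
  have Qn: "fps_nth Q 0 = 1" "fps_nth Q 1 = fps_nth H 2" "fps_nth Q 2 = fps_nth H 3" "fps_nth Q 3 = fps_nth H 4"
    using fps_nth_0_1_has_fps_expansion(1)[OF Q] q0 unfolding HQ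
    by (simp_all add: fps_mult_nth_low)
  obtain W where W: "branch_power (quot_id h) \<mu> has_fps_expansion W" "fps_nth W 0 = 1"
    "Q * fps_deriv W = fps_const (of_real \<mu>) * fps_deriv Q * W"
    by (rule branch_power_fps[OF q q_nz q0 Q])
  obtain V where V: "branch_power (quot_id h) (\<mu> - 1) has_fps_expansion V" "fps_nth V 0 = 1"
    "Q * fps_deriv V = fps_const (of_real (\<mu> - 1)) * fps_deriv Q * V"
    by (rule branch_power_fps[OF q q_nz q0 Q])
  note Wn = fps_power_ode_coeffs[OF W(3) Qn(1) W(2), unfolded Qn, unfolded One_nat_def]
  note Vn = fps_power_ode_coeffs[OF V(3) Qn(1) V(2), unfolded Qn, unfolded One_nat_def]
  let ?N = "fps_const (1 - of_real lam) * W + fps_const (of_real lam) * fps_deriv H * V"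
  have "N_op \<mu> lam h has_fps_expansion ?N"
    unfolding N_op_def[abs_def] by (intro fps_expansion_intros W V H)
  then show thesis
  proof (rule that)
    show "fps_nth ?N 0 = 1"
      using W(2) V(2) H0 by simp
    show "fps_nth ?N 1 = (of_real lam + of_real \<mu>) * fps_nth H 2"
      by (simp add: fps_mult_nth_low fps_deriv_nth_low W V H0 Wn(1) Vn(1) mult.assoc del: fps_deriv_nth)
        (simp add: algebra_simps)
    show "fps_nth ?N 2 = (2 * of_real lam + of_real \<mu>) * (fps_nth H 3 + (of_real \<mu> - 1) / 2 * (fps_nth H 2)\<^sup>2)"
      by (simp add: fps_mult_nth_low fps_deriv_nth_low W V H0 Wn Vn mult.assoc del: fps_deriv_nth)
        (simp add: field_simps power2_eq_square)
    show "fps_nth ?N 3 = (3 * of_real lam + of_real \<mu>) * (fps_nth H 4 + (of_real \<mu> - 1) * fps_nth H 2 * fps_nth H 3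
       + (of_real \<mu> - 1) * (of_real \<mu> - 2) / 6 * fps_nth H 2 ^ 3)"
      by (simp add: fps_mult_nth_low fps_deriv_nth_low W V H0 Wn Vn mult.assoc del: fps_deriv_nth)
        (simp add: field_simps power2_eq_square power3_eq_cube)
  qed
qed

section \<open>Subordination to the Chebyshev generating function\<close>

text \<open>Clearing the denominator turns the subordination into N (1 - 2tW + W^2) = 1, which is
  solved for the coefficients of N one after the other.\<close>

lemma subordinate_cheb_gen_coeffs:
  fixes N0 :: "complex \<Rightarrow> complex" and N :: "complex fps"
  assumes "subordinate N0 (cheb_gen t)" and N: "N0 has_fps_expansion N"
  obtains w :: "complex \<Rightarrow> complex" and W where "w holomorphic_on unit_disc" "w \<in> unit_disc \<rightarrow> unit_disc" "w 0 = 0"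
    "w has_fps_expansion W"
    "fps_nth N 1 = cheb_U 1 t * fps_nth W 1"
    "fps_nth N 2 = cheb_U 1 t * fps_nth W 2 + cheb_U 2 t * (fps_nth W 1)\<^sup>2"
    "fps_nth N 3 = cheb_U 1 t * fps_nth W 3 + 2 * of_real (cheb_U 2 t) * fps_nth W 1 * fps_nth W 2
       + cheb_U 3 t * fps_nth W 1 ^ 3"
proof -
  obtain w where w: "w holomorphic_on unit_disc" "w \<in> unit_disc \<rightarrow> unit_disc" "w 0 = 0"
    and eq: "\<forall>z\<in>unit_disc. N0 z = cheb_gen t (w z)"
    using assms(1) unfolding subordinate_def by blast
  define W where "W = fps_expansion w 0"
  have W: "w has_fps_expansion W"
    unfolding W_def by (rule holomorphic_on_disc_has_fps_expansion[OF w(1)])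
  let ?D = "\<lambda>z. 1 - 2 * complex_of_real t * w z + w z * w z"
  have D: "?D has_fps_expansion 1 - fps_const (2 * complex_of_real t) * W + W * W"
    by (intro fps_expansion_intros W)
  \<comment> \<open>A power series identity needs the denominator to be nonzero only near 0. That
    follows from its value 1 at 0, without locating its zeros.\<close>
  have "continuous (at 0) ?D"
    using has_fps_expansion_imp_continuous[OF D] .
  then have "?D \<midarrow>0\<rightarrow> 1"
    using w(3) by (simp add: continuous_at)
  then have "eventually (\<lambda>z. ?D z \<noteq> 0) (at 0)"
    by (rule tendsto_imp_eventually_ne) simp
  then have nz: "eventually (\<lambda>z. ?D z \<noteq> 0) (nhds 0)"
    using w(3) by (simp add: eventually_nhds_conv_at)
  have "eventually (\<lambda>z. z \<in> unit_disc) (nhds (0::complex))"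
    by (intro eventually_nhds_in_open) auto
  then have "eventually (\<lambda>z. N0 z * ?D z = 1) (nhds 0)"
    using nz by eventually_elim (use eq in \<open>simp add: cheb_gen_def power2_eq_square\<close>)
  then have E: "N * (1 - fps_const (2 * complex_of_real t) * W + W * W) = 1"
    by (intro has_fps_expansion_eventually_eq[OF has_fps_expansion_mult[OF N D] has_fps_expansion_1])
  have W0: "fps_nth W 0 = 0"
    using fps_nth_0_1_has_fps_expansion(1)[OF W] w(3) by simp
  have N0: "fps_nth N 0 = 1"
    using arg_cong[OF E, of "\<lambda>F. fps_nth F 0"] W0 by simp
  have N1: "fps_nth N 1 = 2 * of_real t * fps_nth W 1"
    using arg_cong[OF E, of "\<lambda>F. fps_nth F 1"] by (simp add: fps_mult_nth_low W0 N0 algebra_simps)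
  have N2: "fps_nth N 2 = 2 * of_real t * fps_nth W 2 + (4 * of_real t ^ 2 - 1) * (fps_nth W 1)\<^sup>2"
    using arg_cong[OF E, of "\<lambda>F. fps_nth F 2"]
    by (simp add: fps_mult_nth_low W0 N0 N1[unfolded One_nat_def] field_simps power2_eq_square)
  have N3: "fps_nth N 3 = 2 * of_real t * fps_nth W 3
      + 2 * (4 * of_real t ^ 2 - 1) * fps_nth W 1 * fps_nth W 2
      + (8 * of_real t ^ 3 - 4 * of_real t) * fps_nth W 1 ^ 3"
    using arg_cong[OF E, of "\<lambda>F. fps_nth F 3"]
    by (simp add: fps_mult_nth_low W0 N0 N1[unfolded One_nat_def] N2 field_simps power2_eq_square power3_eq_cube)
  show thesis
    by (rule that[OF w W]) (use N1 N2 N3 in \<open>simp_all add: cheb_U_1[unfolded One_nat_def] cheb_U_2 cheb_U_3\<close>)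
qed

section \<open>Hadamard products and the coefficients of \<open>f_delta\<close>\<close>

text \<open>The defining sum determines Taylor coefficients only once it is known to converge near
  0. Geometric bounds on the two coefficient sequences give convergence on the disc of radius r r',
  and a neighbourhood of 0 is enough.\<close>

lemma hadamard_product_coeff:
  assumes f: "f holomorphic_on unit_disc" and g: "g holomorphic_on unit_disc"
  shows "taylor_coeff (hadamard_product f g) n = taylor_coeff f n * taylor_coeff g n"
proof -
  let ?H = "Abs_fps (\<lambda>n. taylor_coeff f n * taylor_coeff g n)"
  have pos: "conv_radius (taylor_coeff u) > 0" if "u holomorphic_on unit_disc" for u
    using holomorphic_on_disc_has_fps_expansion[OF that]
    by (simp add: has_fps_expansion_def fps_conv_radius_def taylor_coeff_def[abs_def])
  have bnd: "\<exists>r>0. \<exists>B. \<forall>n. norm (taylor_coeff u n) * r ^ n \<le> B"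
    if u: "u holomorphic_on unit_disc" for u
  proof -
    \<comment> \<open>Inside the disc of convergence the terms tend to 0, hence are bounded; this is
      the geometric bound.\<close>
    obtain r where r: "0 < ereal r" "ereal r < conv_radius (taylor_coeff u)"
      using ereal_dense2[OF pos[OF u]] by auto
    then have "summable (\<lambda>n. taylor_coeff u n * of_real r ^ n)"
      by (intro summable_in_conv_radius) simp
    then have "Bseq (\<lambda>n. taylor_coeff u n * of_real r ^ n)"
      by (rule convergent_imp_Bseq[OF convergentI[OF summable_LIMSEQ_zero]])
    then obtain B where "\<And>n. norm (taylor_coeff u n * of_real r ^ n) \<le> B"
      unfolding Bseq_def by blast
    then have "\<forall>n. norm (taylor_coeff u n) * r ^ n \<le> B"
      using r(1) by (simp add: norm_mult norm_power)
    then show ?thesis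
      using r(1) by (intro exI[of _ r] conjI exI[of _ B]) simp_all
  qed
  obtain r B where r: "r > 0" "\<And>n. norm (taylor_coeff f n) * r ^ n \<le> B"
    using bnd[OF f] by blast
  obtain r' B' where r': "r' > 0" "\<And>n. norm (taylor_coeff g n) * r' ^ n \<le> B'"
    using bnd[OF g] by blast
  have "(\<lambda>n. fps_nth ?H n * z ^ n) sums hadamard_product f g z" if z: "z \<in> ball 0 (r * r')" for z
  proof -
    let ?q = "norm z / (r * r')"
    have "norm (taylor_coeff f n * taylor_coeff g n * z ^ n) \<le> B * B' * ?q ^ n" for n
    proof -
      have "norm (taylor_coeff f n * taylor_coeff g n * z ^ n)
          = (norm (taylor_coeff f n) * r ^ n) * (norm (taylor_coeff g n) * r' ^ n) * ?q ^ n"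
        using r(1) r'(1) by (simp add: norm_mult norm_power power_divide power_mult_distrib)
      \<comment> \<open>The instance \<open>r(2)[of 0]\<close> supplies that B is nonnegative, as
        monotonicity of the product requires.\<close>
      also have "\<dots> \<le> B * B' * ?q ^ n"
        using r r' by (intro mult_right_mono mult_mono r r' order_trans[OF _ r(2)[of 0]]) auto
      finally show ?thesis .
    qed
    then have "\<exists>N. \<forall>n\<ge>N. norm (taylor_coeff f n * taylor_coeff g n * z ^ n) \<le> B * B' * ?q ^ n"
      by blast
    moreover have "summable (\<lambda>n. B * B' * ?q ^ n)"
      using z r(1) r'(1) by (intro summable_mult summable_geometric) simp
    ultimately have "summable (\<lambda>n. taylor_coeff f n * taylor_coeff g n * z ^ n)"
      by (rule summable_comparison_test)
    then show ?thesis
      by (simp add: hadamard_product_def summable_sums)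
  qed
  moreover have "eventually (\<lambda>z. z \<in> ball 0 (r * r')) (nhds (0::complex))"
    using r(1) r'(1) by (intro eventually_nhds_in_open) auto
  ultimately have "eventually (\<lambda>z. (\<lambda>n. fps_nth ?H n * z ^ n) sums hadamard_product f g z) (nhds 0)"
    by (auto elim: eventually_mono)
  then have "fps_expansion (hadamard_product f g) 0 = ?H"
    by (intro fps_expansion_eqI has_fps_expansionI)
  then show ?thesis
    by (simp add: taylor_coeff_def)
qed

lemma Re_cayley_pos:
  assumes "norm z < 1"
  shows "Re ((1 + z) / (1 - z)) > 0"
proof -
  have "(1 + Re z) * (1 - Re z) - Im z * Im z = 1 - (norm z)\<^sup>2"
    unfolding cmod_power2 by (simp add: power2_eq_square algebra_simps)
  moreover have "(norm z)\<^sup>2 < 1"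
    using assms by (simp add: power_less_one_iff)
  ultimately have "(1 + Re z) * (1 - Re z) > Im z * Im z"
    by linarith
  moreover have "1 - z \<noteq> 0"
    using assms by auto
  then have "(1 - Re z)\<^sup>2 + (Im z)\<^sup>2 > 0"
    by (metis cmod_power2 minus_complex.sel(1,2) one_complex.sel(1,2) diff_0 power2_minus zero_less_norm_iff zero_less_power)
  ultimately show ?thesis
    by (simp add: Re_divide)
qed

text \<open>With g = (1+z)/(1-z) one has g'/g = 2/(1-z^2), so g^\<delta>/(2\<delta>) is a primitive
  of the integrand. The principal branch is differentiable here because g stays in the right
  half-plane; the -1 is the value g(0)^\<delta> = 1 at the lower limit.\<close>

lemma f_delta_eq:
  assumes "\<delta> > 0" "norm z < 1"
  shows "f_delta \<delta> z = (((1 + z) / (1 - z)) powr of_real \<delta> - 1) / (2 * of_real \<delta>)"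
    and "(f_delta \<delta> has_field_derivative ((1 + z) / (1 - z)) powr of_real \<delta> / (1 - z\<^sup>2)) (at z)"
proof -
  define F where "F = (\<lambda>z. ((1 + z) / (1 - z)) powr complex_of_real \<delta> / (2 * of_real \<delta>))"
  define F' where "F' = (\<lambda>z. ((1 + z) / (1 - z)) powr complex_of_real \<delta> / (1 - z\<^sup>2))"
  have dF: "(F has_field_derivative F' z) (at z)" if z: "norm z < 1" for z
  proof -
    let ?g = "(1 + z) / (1 - z)"
    have Re: "Re ?g > 0"
      by (rule Re_cayley_pos[OF z])
    then have nonpos: "?g \<notin> \<real>\<^sub>\<le>\<^sub>0"
      by (auto simp: complex_nonpos_Reals_iff)
    have nz: "1 - z \<noteq> 0" "1 + z \<noteq> 0" "?g \<noteq> 0"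
      using z Re by (auto simp: add_eq_0_iff)
    have "((\<lambda>z. (1 + z) / (1 - z)) has_field_derivative 2 / (1 - z)\<^sup>2) (at z)"
      using nz by (auto intro!: derivative_eq_intros simp: power2_eq_square)
    from DERIV_chain2[OF has_field_derivative_powr[OF nonpos, of "of_real \<delta>"] this]
    have "((\<lambda>z. ((1 + z) / (1 - z)) powr complex_of_real \<delta>) has_field_derivative
        of_real \<delta> * ?g powr (of_real \<delta> - 1) * (2 / (1 - z)\<^sup>2)) (at z)" .
    then have "(F has_field_derivative
        of_real \<delta> * ?g powr (of_real \<delta> - 1) * (2 / (1 - z)\<^sup>2) / (2 * of_real \<delta>)) (at z)"
      unfolding F_def by (rule DERIV_cdivide)
    moreover have "of_real \<delta> * ?g powr (of_real \<delta> - 1) * (2 / (1 - z)\<^sup>2) / (2 * of_real \<delta>)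
        = ?g powr of_real \<delta> / ?g / (1 - z)\<^sup>2"
    proof -
      have gen: "d * A * (2 / B) / (2 * d) = A / B" if "d \<noteq> 0" for d A B :: complex
        using that by simp
      have "?g powr (of_real \<delta> - 1) = ?g powr of_real \<delta> / ?g"
        using nz by (simp add: powr_diff)
      then show ?thesis
        using assms(1) by (simp only: gen of_real_eq_0_iff less_imp_neq[symmetric] not_False_eq_True)
    qed
    also have "\<dots> = F' z"
    proof -
      have "?g * (1 - z)\<^sup>2 = (1 + z) * (1 - z)"
        using nz by (simp add: power2_eq_square)
      then have "1 - z\<^sup>2 = ?g * (1 - z)\<^sup>2"
        by (simp add: power2_eq_square algebra_simps)
      then show ?thesis
        by (simp add: F'_def)
    qed
    ultimately show ?thesis
      by simp
  qed
  have eq: "f_delta \<delta> z = F z - F 0" if z: "norm z < 1" for z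
  proof -
    have "(F' has_contour_integral (F (pathfinish (linepath 0 z)) - F (pathstart (linepath 0 z)))) (linepath 0 z)"
    proof (rule contour_integral_primitive)
      show "path_image (linepath 0 z) \<subseteq> unit_disc"
        using z by (simp add: closed_segment_subset)
      show "valid_path (linepath 0 z)"
        by (rule valid_path_linepath)
    qed (use dF in \<open>auto intro: has_field_derivative_at_within\<close>)
    then show ?thesis
      using contour_integral_unique by (simp add: f_delta_def F'_def)
  qed
  show "f_delta \<delta> z = (((1 + z) / (1 - z)) powr of_real \<delta> - 1) / (2 * of_real \<delta>)"
    using eq[OF assms(2)] by (simp add: F_def diff_divide_distrib)
  have "((\<lambda>z. F z - F 0) has_field_derivative F' z) (at z)"
    using dF[OF assms(2)] by (auto intro!: derivative_eq_intros)
  then have "(f_delta \<delta> has_field_derivative F' z) (at z)"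
    by (rule has_field_derivative_transform_within_open[where S = unit_disc]) (use eq assms(2) in auto)
  then show "(f_delta \<delta> has_field_derivative ((1 + z) / (1 - z)) powr of_real \<delta> / (1 - z\<^sup>2)) (at z)"
    by (simp add: F'_def)
qed

lemma f_delta_holomorphic:
  assumes "\<delta> > 0"
  shows "f_delta \<delta> holomorphic_on unit_disc"
proof -
  have "f_delta \<delta> field_differentiable (at z)" if "norm z < 1" for z
    using f_delta_eq(2)[OF assms that] field_differentiable_def by blast
  then show ?thesis
    by (auto simp: holomorphic_on_def intro: field_differentiable_at_within)
qed

text \<open>The closed form yields (1 - z^2) f' = 2\<delta> f + 1, that is, (n+1) b_{n+1} =
  2\<delta> b_n + (n-1) b_{n-1} for n >= 1.\<close>

lemma f_delta_coeffs:
  assumes "\<delta> > 0"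
  shows "taylor_coeff (f_delta \<delta>) 2 = of_real \<delta>"
    and "taylor_coeff (f_delta \<delta>) 3 = of_real ((2 * \<delta>\<^sup>2 + 1) / 3)"
    and "taylor_coeff (f_delta \<delta>) 4 = of_real ((\<delta> ^ 3 + 2 * \<delta>) / 3)"
proof -
  define F where "F = fps_expansion (f_delta \<delta>) 0"
  have F: "f_delta \<delta> has_fps_expansion F"
    unfolding F_def by (rule holomorphic_on_disc_has_fps_expansion[OF f_delta_holomorphic[OF assms]])
  have ode: "(1 - fps_X * fps_X) * fps_deriv F = fps_const (2 * of_real \<delta>) * F + 1"
  proof (rule has_fps_expansion_eq_on_disc)
    show "(\<lambda>z. (1 - z * z) * deriv (f_delta \<delta>) z) has_fps_expansion (1 - fps_X * fps_X) * fps_deriv F"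
      by (intro fps_expansion_intros F)
    show "(\<lambda>z. 2 * of_real \<delta> * f_delta \<delta> z + 1) has_fps_expansion fps_const (2 * of_real \<delta>) * F + 1"
      by (intro fps_expansion_intros F)
    fix z :: complex assume "z \<in> unit_disc"
    then have z: "norm z < 1" by simp
    have "1 - z \<noteq> 0" "1 + z \<noteq> 0"
      using z by (auto simp: add_eq_0_iff)
    then have nz: "1 - z * z \<noteq> 0"
      by (metis mult_eq_0_iff square_diff_one_factored minus_diff_eq add.commute neg_equal_0_iff_equal)
    have d: "deriv (f_delta \<delta>) z = ((1 + z) / (1 - z)) powr of_real \<delta> / (1 - z * z)"
      using DERIV_imp_deriv[OF f_delta_eq(2)[OF assms z]] by (simp add: power2_eq_square)
    show "(1 - z * z) * deriv (f_delta \<delta>) z = 2 * of_real \<delta> * f_delta \<delta> z + 1"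
      unfolding d f_delta_eq(1)[OF assms z] using nz assms by simp
  qed
  have F0: "fps_nth F 0 = 0"
    using fps_nth_0_1_has_fps_expansion(1)[OF F] f_delta_eq(1)[OF assms, of 0] by simp
  have F1: "fps_nth F (Suc 0) = 1"
    using arg_cong[OF ode, of "\<lambda>F. fps_nth F 0"] F0 by (simp add: fps_deriv_nth_low del: fps_deriv_nth)
  have F2: "fps_nth F 2 = of_real \<delta>"
    using arg_cong[OF ode, of "\<lambda>F. fps_nth F (Suc 0)"] F0 F1
    by (simp add: fps_mult_nth_low fps_deriv_nth_low del: fps_deriv_nth)
  have F3: "fps_nth F 3 = (2 * (of_real \<delta>)\<^sup>2 + 1) / 3"
    using arg_cong[OF ode, of "\<lambda>F. fps_nth F 2"] F0 F1 F2
    by (simp add: fps_mult_nth_low fps_deriv_nth_low field_simps power2_eq_square del: fps_deriv_nth)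
  have F4: "fps_nth F 4 = (of_real \<delta> ^ 3 + 2 * of_real \<delta>) / 3"
    using arg_cong[OF ode, of "\<lambda>F. fps_nth F 3"] F0 F1 F2 F3
    by (simp add: fps_mult_nth_low fps_deriv_nth_low del: fps_deriv_nth)
      (simp add: field_simps power2_eq_square power3_eq_cube, algebra)
  show "taylor_coeff (f_delta \<delta>) 2 = of_real \<delta>"
    "taylor_coeff (f_delta \<delta>) 3 = of_real ((2 * \<delta>\<^sup>2 + 1) / 3)"
    "taylor_coeff (f_delta \<delta>) 4 = of_real ((\<delta> ^ 3 + 2 * \<delta>) / 3)"
    using F2 F3 F4 by (simp_all add: taylor_coeff_def F_def)
qed

section \<open>Coefficients of the inverse function\<close>

text \<open>The composition h(k(w)) = w near 0 becomes \<open>fps_compose H K = fps_X\<close>. Since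
  H has linear coefficient 1, the n-th coefficient of K enters the n-th equation linearly and can be
  solved for.\<close>

lemma univalent_inverse_coeffs:
  assumes h: "h \<in> class_A" "inj_on h unit_disc" and H: "h has_fps_expansion H"
    and k: "univalent_inverse h k"
  obtains K where "k has_fps_expansion K" "k 0 = 0" "deriv k 0 = 1"
    "fps_nth K 2 = - fps_nth H 2"
    "fps_nth K 3 = 2 * (fps_nth H 2)\<^sup>2 - fps_nth H 3"
    "fps_nth K 4 = - (5 * fps_nth H 2 ^ 3 - 5 * fps_nth H 2 * fps_nth H 3 + fps_nth H 4)"
proof -
  have hol: "h holomorphic_on unit_disc" and h0: "h 0 = 0" "deriv h 0 = 1"
    using h(1) by (auto simp: class_A_def)
  have khol: "k holomorphic_on unit_disc" and kinv: "eventually (\<lambda>w. k w = inv_into unit_disc h w) (nhds 0)"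
    using k by (auto simp: univalent_inverse_def)
  define K where "K = fps_expansion k 0"
  have K: "k has_fps_expansion K"
    unfolding K_def by (rule holomorphic_on_disc_has_fps_expansion[OF khol])
  \<comment> \<open>A property that holds eventually in \<open>nhds 0\<close> holds at 0 itself. The
    resulting k 0 = 0 is what makes the composition of formal series legitimate.\<close>
  have "k 0 = inv_into unit_disc h (h 0)"
    using eventually_nhds_x_imp_x[OF kinv] h0 by simp
  then have k0: "k 0 = 0"
    using inv_into_f_f[OF h(2), of 0] by simp
  have K0: "fps_nth K 0 = 0"
    using fps_nth_0_1_has_fps_expansion(1)[OF K] k0 by simp
  \<comment> \<open>\<open>inv_into\<close> is a right inverse only on the image of h, so that image
    has to be a neighbourhood of 0.\<close>
  have "open (h ` unit_disc)"
    by (rule open_mapping_thm3[OF hol open_ball h(2)])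
  then have "eventually (\<lambda>w. w \<in> h ` unit_disc) (nhds 0)"
    using h0 by (intro eventually_nhds_in_open) (auto intro!: image_eqI[of _ _ 0])
  then have "eventually (\<lambda>w. (h \<circ> k) w = w) (nhds 0)"
    using kinv by eventually_elim (simp add: f_inv_into_f)
  then have E: "fps_compose H K = fps_X"
    by (rule has_fps_expansion_eventually_eq[OF has_fps_expansion_compose[OF H K K0] has_fps_expansion_fps_X])
  have H0: "fps_nth H 0 = 0" and H1: "fps_nth H (Suc 0) = 1"
    using fps_nth_0_1_has_fps_expansion[OF H] h0 by simp_all
  have *: "fps_nth (K ^ 2) i = fps_nth (K * K) i" "fps_nth (K ^ 3) i = fps_nth (K * (K * K)) i"
    "fps_nth (K ^ 4) i = fps_nth (K * (K * (K * K))) i" for i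
    by (simp_all add: eval_nat_numeral)
  have s: "{0..Suc 0} = {0, Suc 0}" "{0..2::nat} = {0, Suc 0, 2}" "{0..3::nat} = {0, Suc 0, 2, 3}"
    "{0..4::nat} = {0, Suc 0, 2, 3, 4}"
    by auto
  have K1: "fps_nth K (Suc 0) = 1"
    using arg_cong[OF E, of "\<lambda>F. fps_nth F (Suc 0)"] by (simp add: fps_compose_nth s H0 H1)
  note lo = fps_mult_nth_low[unfolded One_nat_def]
  have K2: "fps_nth K 2 = - fps_nth H 2"
    using arg_cong[OF E, of "\<lambda>F. fps_nth F 2"]
    by (simp add: fps_compose_nth s H0 H1 K0 K1 * lo add_eq_0_iff)
  have K3: "fps_nth K 3 = 2 * (fps_nth H 2)\<^sup>2 - fps_nth H 3"
    using arg_cong[OF E, of "\<lambda>F. fps_nth F 3"]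
    by (simp add: fps_compose_nth s H0 H1 K0 K1 K2 * lo) (simp add: algebra_simps power2_eq_square)
  have K4: "fps_nth K 4 = - (5 * fps_nth H 2 ^ 3 - 5 * fps_nth H 2 * fps_nth H 3 + fps_nth H 4)"
    using arg_cong[OF E, of "\<lambda>F. fps_nth F 4"]
    by (simp add: fps_compose_nth s H0 H1 K0 K1 K2 K3 * lo) (simp add: algebra_simps power2_eq_square power3_eq_cube)
  show thesis
    by (rule that[OF K k0 _ K2 K3 K4]) (use fps_nth_0_1_has_fps_expansion(2)[OF K] K1 in simp)
qed

section \<open>The second Hankel determinant\<close>

text \<open>Since the first coefficients of the two Schwarz functions are opposite, subtracting the
  second-order equations cancels the V terms and isolates a_3. Subtracting the third-order ones
  isolates a_4, doubles the X term and leaves V multiplied by d_2 + e_2.\<close>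

lemma hankel_identity:
  fixes a\<^sub>2 a\<^sub>3 a\<^sub>4 :: complex
  assumes nz: "M\<^sub>1 \<noteq> 0" "M\<^sub>2 \<noteq> 0" "M\<^sub>3 \<noteq> 0" "b\<^sub>2 \<noteq> 0" "b\<^sub>3 \<noteq> 0" "b\<^sub>4 \<noteq> 0"
    and h1: "M\<^sub>1 * (a\<^sub>2 * b\<^sub>2) = U * d\<^sub>1"
    and h2: "M\<^sub>2 * (a\<^sub>3 * b\<^sub>3 + (\<mu> - 1) / 2 * (a\<^sub>2 * b\<^sub>2)\<^sup>2) = U * d\<^sub>2 + V * d\<^sub>1\<^sup>2"
    and h3: "M\<^sub>3 * (a\<^sub>4 * b\<^sub>4 + (\<mu> - 1) * (a\<^sub>2 * b\<^sub>2) * (a\<^sub>3 * b\<^sub>3) + (\<mu> - 1) * (\<mu> - 2) / 6 * (a\<^sub>2 * b\<^sub>2) ^ 3)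
        = U * d\<^sub>3 + 2 * V * d\<^sub>1 * d\<^sub>2 + X * d\<^sub>1 ^ 3"
    and k2: "M\<^sub>2 * (2 * (a\<^sub>2 * b\<^sub>2)\<^sup>2 - a\<^sub>3 * b\<^sub>3 + (\<mu> - 1) / 2 * (- (a\<^sub>2 * b\<^sub>2))\<^sup>2) = U * e\<^sub>2 + V * (- d\<^sub>1)\<^sup>2"
    and k3: "M\<^sub>3 * (- (5 * (a\<^sub>2 * b\<^sub>2) ^ 3 - 5 * (a\<^sub>2 * b\<^sub>2) * (a\<^sub>3 * b\<^sub>3) + a\<^sub>4 * b\<^sub>4)
          + (\<mu> - 1) * (- (a\<^sub>2 * b\<^sub>2)) * (2 * (a\<^sub>2 * b\<^sub>2)\<^sup>2 - a\<^sub>3 * b\<^sub>3)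
          + (\<mu> - 1) * (\<mu> - 2) / 6 * (- (a\<^sub>2 * b\<^sub>2)) ^ 3)
        = U * e\<^sub>3 + 2 * V * (- d\<^sub>1) * e\<^sub>2 + X * (- d\<^sub>1) ^ 3"
  shows "a\<^sub>2 * a\<^sub>4 - a\<^sub>3\<^sup>2
    = U * (X / (b\<^sub>2 * b\<^sub>4 * M\<^sub>1 * M\<^sub>3) - U ^ 3 * (\<mu>\<^sup>2 + 3 * \<mu> - 4) / (6 * b\<^sub>2 * b\<^sub>4 * M\<^sub>1 ^ 4) - U ^ 3 / (b\<^sub>3\<^sup>2 * M\<^sub>1 ^ 4)) * d\<^sub>1 ^ 4
      + U ^ 3 * (5 / (4 * b\<^sub>2 * b\<^sub>4 * M\<^sub>1\<^sup>2 * M\<^sub>2) - 1 / (b\<^sub>3\<^sup>2 * M\<^sub>1\<^sup>2 * M\<^sub>2)) * (d\<^sub>1\<^sup>2 * (d\<^sub>2 - e\<^sub>2))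
      + U * V / (b\<^sub>2 * b\<^sub>4 * M\<^sub>1 * M\<^sub>3) * (d\<^sub>1\<^sup>2 * (d\<^sub>2 + e\<^sub>2))
      + U\<^sup>2 / (2 * b\<^sub>2 * b\<^sub>4 * M\<^sub>1 * M\<^sub>3) * (d\<^sub>1 * (d\<^sub>3 - e\<^sub>3))
      - U\<^sup>2 / (4 * b\<^sub>3\<^sup>2 * M\<^sub>2\<^sup>2) * (d\<^sub>2 - e\<^sub>2)\<^sup>2"
proof -
  define A\<^sub>2 A\<^sub>3 A\<^sub>4 where "A\<^sub>2 = a\<^sub>2 * b\<^sub>2" and "A\<^sub>3 = a\<^sub>3 * b\<^sub>3" and "A\<^sub>4 = a\<^sub>4 * b\<^sub>4"
  note A = A\<^sub>2_def[symmetric] A\<^sub>3_def[symmetric] A\<^sub>4_def[symmetric]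
  note h1 = h1[unfolded A] and h2 = h2[unfolded A] and h3 = h3[unfolded A]
    and k2 = k2[unfolded A] and k3 = k3[unfolded A]
  have e1: "A\<^sub>2 = U * d\<^sub>1 / M\<^sub>1"
    using h1 nz by (simp add: field_simps)
  have "2 * M\<^sub>2 * (A\<^sub>3 - A\<^sub>2\<^sup>2) = U * (d\<^sub>2 - e\<^sub>2)"
  proof -
    \<comment> \<open>The fraction becomes an atom so that the claim is polynomial; it cancels
      because the square of a_2 has the same coefficient in both equations.\<close>
    define m where "m = (\<mu> - 1) / 2"
    show ?thesis
      using h2 k2 unfolding m_def[symmetric] by algebra
  qed
  then have e2: "A\<^sub>3 = A\<^sub>2\<^sup>2 + U * (d\<^sub>2 - e\<^sub>2) / (2 * M\<^sub>2)"
    using nz by (simp add: field_simps)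
  have "M\<^sub>3 * (2 * A\<^sub>4 + 5 * A\<^sub>2 ^ 3 - 5 * A\<^sub>2 * A\<^sub>3 + 2 * (\<mu> - 1) * A\<^sub>2 ^ 3 + 2 * ((\<mu> - 1) * (\<mu> - 2) / 6 * A\<^sub>2 ^ 3))
      = U * (d\<^sub>3 - e\<^sub>3) + 2 * V * d\<^sub>1 * (d\<^sub>2 + e\<^sub>2) + 2 * X * d\<^sub>1 ^ 3"
  proof -
    define m where "m = (\<mu> - 1) * (\<mu> - 2) / 6"
    show ?thesis
      using h3 k3 unfolding m_def[symmetric] by algebra
  qed
  then have e4: "2 * A\<^sub>4 + 5 * A\<^sub>2 ^ 3 - 5 * A\<^sub>2 * A\<^sub>3 + 2 * (\<mu> - 1) * A\<^sub>2 ^ 3 + 2 * ((\<mu> - 1) * (\<mu> - 2) / 6 * A\<^sub>2 ^ 3)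
      = (U * (d\<^sub>3 - e\<^sub>3) + 2 * V * d\<^sub>1 * (d\<^sub>2 + e\<^sub>2) + 2 * X * d\<^sub>1 ^ 3) / M\<^sub>3"
    by (metis nonzero_mult_div_cancel_left nz(3))
  have e3: "A\<^sub>4 = 5 * A\<^sub>2 * (U * (d\<^sub>2 - e\<^sub>2) / (2 * M\<^sub>2)) / 2 - (\<mu>\<^sup>2 + 3 * \<mu> - 4) / 6 * A\<^sub>2 ^ 3
      + (U * (d\<^sub>3 - e\<^sub>3) + 2 * V * d\<^sub>1 * (d\<^sub>2 + e\<^sub>2) + 2 * X * d\<^sub>1 ^ 3) / M\<^sub>3 / 2"
  proof -
    have *: "A\<^sub>4 = 5 * A\<^sub>2 * Y / 2 - (\<mu>\<^sup>2 + 3 * \<mu> - 4) / 6 * A\<^sub>2 ^ 3 + Z / 2"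
      if Z: "2 * A\<^sub>4 + 5 * A\<^sub>2 ^ 3 - 5 * A\<^sub>2 * (A\<^sub>2\<^sup>2 + Y) + 2 * (\<mu> - 1) * A\<^sub>2 ^ 3
        + 2 * ((\<mu> - 1) * (\<mu> - 2) / 6 * A\<^sub>2 ^ 3) = Z" for Y Z
    proof -
      define m where "m = (\<mu> - 1) * (\<mu> - 2) / 6"
      \<comment> \<open>The cubes of A_2 combine to -(\<mu> - 1) - m = -(\<mu> - 1)(\<mu> + 4)/6,
        the origin of \<mu>^2 + 3\<mu> - 4.\<close>
      have "6 * m = (\<mu> - 1) * (\<mu> - 2)"
        by (simp add: m_def)
      then have "A\<^sub>4 * 6 = 15 * (A\<^sub>2 * Y) - (\<mu>\<^sup>2 + 3 * \<mu> - 4) * A\<^sub>2 ^ 3 + 3 * Z"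
        using Z unfolding m_def[symmetric] by algebra
      then show ?thesis
        by (simp add: field_simps)
    qed
    show ?thesis
      by (rule *[OF e4[unfolded e2]])
  qed
  have "a\<^sub>2 * a\<^sub>4 - a\<^sub>3\<^sup>2 = A\<^sub>2 * A\<^sub>4 / (b\<^sub>2 * b\<^sub>4) - A\<^sub>3\<^sup>2 / b\<^sub>3\<^sup>2"
    using nz by (simp add: A\<^sub>2_def A\<^sub>3_def A\<^sub>4_def power_mult_distrib)
  also have "\<dots> = U * (X / (b\<^sub>2 * b\<^sub>4 * M\<^sub>1 * M\<^sub>3) - U ^ 3 * (\<mu>\<^sup>2 + 3 * \<mu> - 4) / (6 * b\<^sub>2 * b\<^sub>4 * M\<^sub>1 ^ 4) - U ^ 3 / (b\<^sub>3\<^sup>2 * M\<^sub>1 ^ 4)) * d\<^sub>1 ^ 4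
      + U ^ 3 * (5 / (4 * b\<^sub>2 * b\<^sub>4 * M\<^sub>1\<^sup>2 * M\<^sub>2) - 1 / (b\<^sub>3\<^sup>2 * M\<^sub>1\<^sup>2 * M\<^sub>2)) * (d\<^sub>1\<^sup>2 * (d\<^sub>2 - e\<^sub>2))
      + U * V / (b\<^sub>2 * b\<^sub>4 * M\<^sub>1 * M\<^sub>3) * (d\<^sub>1\<^sup>2 * (d\<^sub>2 + e\<^sub>2))
      + U\<^sup>2 / (2 * b\<^sub>2 * b\<^sub>4 * M\<^sub>1 * M\<^sub>3) * (d\<^sub>1 * (d\<^sub>3 - e\<^sub>3))
      - U\<^sup>2 / (4 * b\<^sub>3\<^sup>2 * M\<^sub>2\<^sup>2) * (d\<^sub>2 - e\<^sub>2)\<^sup>2"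
  proof -
    \<comment> \<open>With the inverses named, a polynomial identity with numerical fractions
      remains.\<close>
    define i\<^sub>1 i\<^sub>2 i\<^sub>3 where "i\<^sub>1 = inverse M\<^sub>1" and "i\<^sub>2 = inverse M\<^sub>2" and "i\<^sub>3 = inverse M\<^sub>3"
    define j\<^sub>2 j\<^sub>3 j\<^sub>4 where "j\<^sub>2 = inverse b\<^sub>2" and "j\<^sub>3 = inverse b\<^sub>3" and "j\<^sub>4 = inverse b\<^sub>4"
    note ij = i\<^sub>1_def i\<^sub>2_def i\<^sub>3_def j\<^sub>2_def j\<^sub>3_def j\<^sub>4_def
    show ?thesis
      unfolding e3 e2 e1 divide_inverse inverse_mult_distrib power_inverse[symmetric] ij[symmetric]
      by (simp add: field_simps power2_eq_square power3_eq_cube power4_eq_xxxx)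
  qed
  finally show ?thesis .
qed

section \<open>Maximisation over the real parameters\<close>

text \<open>Lowering p and q from 1 raises the \<open>cs\<close> term by at most a multiple of 4 -
  (p+q)^2 and lowers the \<open>cxx\<close> term by another multiple of it. The hypothesis
  \<open>cs \<le> 4 * cxx\<close> is what makes the second multiple dominate for every r in
  [0,1].\<close>

lemma hankel_max_at_one:
  fixes r p q :: real
  assumes r: "0 \<le> r" "r \<le> 1" and p: "0 \<le> p" "p \<le> 1" and q: "0 \<le> q" "q \<le> 1"
    and c: "0 \<le> cx" "0 \<le> cs" "cs \<le> 4 * cxx"
  shows "cx * (r\<^sup>2 * ((1 - r\<^sup>2) * (p + q))) + cs * (r * ((1 - r\<^sup>2) * (1 - p\<^sup>2 + r * p\<^sup>2) + (1 - r\<^sup>2) * (1 - q\<^sup>2 + r * q\<^sup>2)))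
      + cxx * ((1 - r\<^sup>2) * (p + q))\<^sup>2
    \<le> 2 * (cx + cs) * (r\<^sup>2 * (1 - r\<^sup>2)) + 4 * cxx * (1 - r\<^sup>2)\<^sup>2"
proof -
  let ?\<sigma> = "p + q"
  have r2: "0 \<le> 1 - r\<^sup>2"
    using r by (simp add: power_le_one)
  have "0 \<le> (p - q)\<^sup>2" by simp
  then have pq: "2 - p\<^sup>2 - q\<^sup>2 \<le> (4 - ?\<sigma>\<^sup>2) / 2"
    by (simp add: power2_eq_square algebra_simps)
  have \<sigma>: "?\<sigma>\<^sup>2 \<le> 2\<^sup>2"
    using p q by (intro power_mono) auto
  \<comment> \<open>The slack 2r <= 1 + r produces the factor 1 + r that completes 1 - r to 1 -
    r^2.\<close>
  have "cs * r \<le> (4 * cxx) * r"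
    using c r by (intro mult_right_mono) auto
  also have "\<dots> \<le> 2 * cxx * (1 + r)"
    using c r mult_left_mono[of "2 * r" "1 + r" "2 * cxx"] by (simp add: algebra_simps)
  finally have key: "cs * r \<le> 2 * cxx * (1 + r)" .
  have "cs * r * (1 - r) * (2 - p\<^sup>2 - q\<^sup>2) \<le> cs * r * (1 - r) * ((4 - ?\<sigma>\<^sup>2) / 2)"
    using c r pq by (intro mult_left_mono) auto
  also have "\<dots> \<le> (2 * cxx * (1 + r)) * (1 - r) * ((4 - ?\<sigma>\<^sup>2) / 2)"
    using key r \<sigma> by (intro mult_right_mono) auto
  also have "\<dots> = cxx * (1 - r\<^sup>2) * (4 - ?\<sigma>\<^sup>2)"
    by (simp add: power2_eq_square field_simps)
  finally have 1: "(1 - r\<^sup>2) * (cs * r * (1 - r) * (2 - p\<^sup>2 - q\<^sup>2)) \<le> (1 - r\<^sup>2) * (cxx * (1 - r\<^sup>2) * (4 - ?\<sigma>\<^sup>2))"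
    using r2 by (rule mult_left_mono)
  have 2: "0 \<le> cx * (r\<^sup>2 * (1 - r\<^sup>2)) * (2 - ?\<sigma>)"
    using c r2 p q by (intro mult_nonneg_nonneg) auto
  \<comment> \<open>The gap between the two sides splits exactly into the two quantities just shown
    to be nonnegative.\<close>
  have "2 * (cx + cs) * (r\<^sup>2 * (1 - r\<^sup>2)) + 4 * cxx * (1 - r\<^sup>2)\<^sup>2
    - (cx * (r\<^sup>2 * ((1 - r\<^sup>2) * ?\<sigma>)) + cs * (r * ((1 - r\<^sup>2) * (1 - p\<^sup>2 + r * p\<^sup>2) + (1 - r\<^sup>2) * (1 - q\<^sup>2 + r * q\<^sup>2)))
      + cxx * ((1 - r\<^sup>2) * ?\<sigma>)\<^sup>2)
    = cx * (r\<^sup>2 * (1 - r\<^sup>2)) * (2 - ?\<sigma>)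
      + ((1 - r\<^sup>2) * (cxx * (1 - r\<^sup>2) * (4 - ?\<sigma>\<^sup>2)) - (1 - r\<^sup>2) * (cs * r * (1 - r) * (2 - p\<^sup>2 - q\<^sup>2)))"
    by algebra
  then show ?thesis
    using 1 2 by linarith
qed

text \<open>For nonnegative or nonpositive coefficients the quadratic is extremal at x = 1 or x = 0.
  A convex one lies below its chord over [0,1]. A concave one lies below its vertex value, whose
  abscissa -9 c_2/(2 c_1) is c0^2/4 when c_1 and c_2 are \<open>chi1\<close> and
  \<open>chi2\<close>.\<close>

lemma quadratic_bound_cases:
  fixes c\<^sub>1 c\<^sub>2 K D x :: real
  assumes "D > 0" "0 \<le> x" "x \<le> 1"
  shows "c\<^sub>1 \<ge> 0 \<Longrightarrow> c\<^sub>2 \<ge> 0 \<Longrightarrow> K + (c\<^sub>1 * x\<^sup>2 + 9 * c\<^sub>2 * x) / D \<le> K + (c\<^sub>1 + 9 * c\<^sub>2) / D"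
    and "c\<^sub>1 \<le> 0 \<Longrightarrow> c\<^sub>2 \<le> 0 \<Longrightarrow> K + (c\<^sub>1 * x\<^sup>2 + 9 * c\<^sub>2 * x) / D \<le> K"
    and "c\<^sub>1 > 0 \<Longrightarrow> K + (c\<^sub>1 * x\<^sup>2 + 9 * c\<^sub>2 * x) / D \<le> max K (K + (c\<^sub>1 + 9 * c\<^sub>2) / D)"
    and "c\<^sub>1 < 0 \<Longrightarrow> K + (c\<^sub>1 * x\<^sup>2 + 9 * c\<^sub>2 * x) / D \<le> K - 81 * c\<^sub>2\<^sup>2 / (4 * c\<^sub>1 * D)"
proof -
  have x2: "0 \<le> x\<^sup>2" "x\<^sup>2 \<le> x" "x\<^sup>2 \<le> 1"
    using assms(2,3) mult_left_mono[of x 1 x] by (auto simp: power2_eq_square power_le_one mult_le_one)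
  show "K + (c\<^sub>1 * x\<^sup>2 + 9 * c\<^sub>2 * x) / D \<le> K + (c\<^sub>1 + 9 * c\<^sub>2) / D" if "c\<^sub>1 \<ge> 0" "c\<^sub>2 \<ge> 0"
  proof -
    have "c\<^sub>1 * x\<^sup>2 \<le> c\<^sub>1" "9 * c\<^sub>2 * x \<le> 9 * c\<^sub>2"
      using that x2 assms by (simp_all add: mult_left_le)
    then show ?thesis
      using assms(1) by (simp add: divide_right_mono)
  qed
  show "K + (c\<^sub>1 * x\<^sup>2 + 9 * c\<^sub>2 * x) / D \<le> K" if "c\<^sub>1 \<le> 0" "c\<^sub>2 \<le> 0"
  proof -
    have "c\<^sub>1 * x\<^sup>2 \<le> 0" "9 * c\<^sub>2 * x \<le> 0"
      using that x2 assms by (simp_all add: mult_nonpos_nonneg)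
    then show ?thesis
      using assms(1) by (simp add: divide_nonpos_pos)
  qed
  show "K + (c\<^sub>1 * x\<^sup>2 + 9 * c\<^sub>2 * x) / D \<le> max K (K + (c\<^sub>1 + 9 * c\<^sub>2) / D)" if "c\<^sub>1 > 0"
  proof -
    have le: "c\<^sub>1 * x\<^sup>2 + 9 * c\<^sub>2 * x \<le> x * (c\<^sub>1 + 9 * c\<^sub>2)"
      using mult_left_mono[OF x2(2), of c\<^sub>1] that by (simp add: algebra_simps)
    have "x * (c\<^sub>1 + 9 * c\<^sub>2) \<le> max 0 (c\<^sub>1 + 9 * c\<^sub>2)"
    proof (cases "c\<^sub>1 + 9 * c\<^sub>2 \<ge> 0")
      case True
      then show ?thesis
        using mult_right_mono[OF assms(3) True] by simp
    next
      case False
      then show ?thesis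
        using assms(2) by (simp add: mult_nonneg_nonpos)
    qed
    then have "(c\<^sub>1 * x\<^sup>2 + 9 * c\<^sub>2 * x) / D \<le> max 0 (c\<^sub>1 + 9 * c\<^sub>2) / D"
      using le assms(1) by (intro divide_right_mono) auto
    also have "\<dots> \<le> max 0 ((c\<^sub>1 + 9 * c\<^sub>2) / D)"
      using assms(1) by (auto simp: max_def divide_nonneg_pos)
    finally show ?thesis
      by linarith
  qed
  show "K + (c\<^sub>1 * x\<^sup>2 + 9 * c\<^sub>2 * x) / D \<le> K - 81 * c\<^sub>2\<^sup>2 / (4 * c\<^sub>1 * D)" if "c\<^sub>1 < 0"
  proof -
    have "c\<^sub>1 * x\<^sup>2 + 9 * c\<^sub>2 * x = c\<^sub>1 * (x + 9 * c\<^sub>2 / (2 * c\<^sub>1))\<^sup>2 - 81 * c\<^sub>2\<^sup>2 / (4 * c\<^sub>1)"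
      using that by (simp add: field_simps power2_eq_square)
    also have "\<dots> \<le> - 81 * c\<^sub>2\<^sup>2 / (4 * c\<^sub>1)"
      using that by (simp add: mult_nonpos_nonneg)
    finally have "(c\<^sub>1 * x\<^sup>2 + 9 * c\<^sub>2 * x) / D \<le> - 81 * c\<^sub>2\<^sup>2 / (4 * c\<^sub>1) / D"
      using assms(1) by (intro divide_right_mono) auto
    then show ?thesis
      by simp
  qed
qed

section \<open>Signs of the weights and their relation to \<open>chi1\<close> and
  \<open>chi2\<close>\<close>

text \<open>D is a common denominator of the weights in \<open>hankel_identity\<close>. All of them
  are nonnegative except possibly \<open>c\<^sub>4\<close>, whose sign is left open and which
  therefore enters as |Om|. At p = q = 1 and x = r^2 the estimate is |c_4| x^2 + 2 (cx + cy + cs) x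
  (1 - x) + 4 cxx (1 - x)^2, and its coefficients of x^2 and x, multiplied by D, are
  \<open>chi1\<close> and 9 \<open>chi2\<close>.\<close>

lemma hankel_weights:
  fixes lam \<mu> \<delta> t :: real
  assumes par: "lam \<ge> 1" "\<mu> \<ge> 0" "\<delta> \<ge> 1" "1/2 < t"
  defines "b\<^sub>3 \<equiv> (2 * \<delta>\<^sup>2 + 1) / 3" and "b\<^sub>4 \<equiv> (\<delta> ^ 3 + 2 * \<delta>) / 3"
    and "M\<^sub>1 \<equiv> lam + \<mu>" and "M\<^sub>2 \<equiv> 2 * lam + \<mu>" and "M\<^sub>3 \<equiv> 3 * lam + \<mu>"
    and "U \<equiv> cheb_U 1 t" and "V \<equiv> cheb_U 2 t" and "X \<equiv> cheb_U 3 t"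
  defines "c\<^sub>4 \<equiv> U * (X / (\<delta> * b\<^sub>4 * M\<^sub>1 * M\<^sub>3) - U ^ 3 * (\<mu>\<^sup>2 + 3 * \<mu> - 4) / (6 * \<delta> * b\<^sub>4 * M\<^sub>1 ^ 4) - U ^ 3 / (b\<^sub>3\<^sup>2 * M\<^sub>1 ^ 4))"
    and "cx \<equiv> U ^ 3 * (5 / (4 * \<delta> * b\<^sub>4 * M\<^sub>1\<^sup>2 * M\<^sub>2) - 1 / (b\<^sub>3\<^sup>2 * M\<^sub>1\<^sup>2 * M\<^sub>2))"
    and "cy \<equiv> U * V / (\<delta> * b\<^sub>4 * M\<^sub>1 * M\<^sub>3)"
    and "cs \<equiv> U\<^sup>2 / (2 * \<delta> * b\<^sub>4 * M\<^sub>1 * M\<^sub>3)"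
    and "cxx \<equiv> U\<^sup>2 / (4 * b\<^sub>3\<^sup>2 * M\<^sub>2\<^sup>2)"
    and "D \<equiv> 6 * \<delta> * (\<delta> ^ 3 + 2 * \<delta>) * (2 * \<delta>\<^sup>2 + 1)\<^sup>2 * (3 * lam + \<mu>) * (2 * lam + \<mu>)\<^sup>2 * (lam + \<mu>) ^ 4"
  shows "0 \<le> cx" "0 \<le> cy" "0 \<le> cs" "0 \<le> cxx" "cs \<le> 4 * cxx" "D > 0"
    and "chi1 lam \<mu> \<delta> t = D * (\<bar>c\<^sub>4\<bar> - 2 * (cx + cy + cs) + 4 * cxx)"
    and "9 * chi2 lam \<mu> \<delta> t = D * (2 * (cx + cy + cs) - 8 * cxx)"
    and "9 * (cheb_U 1 t)\<^sup>2 / ((2 * \<delta>\<^sup>2 + 1)\<^sup>2 * (2 * lam + \<mu>)\<^sup>2) = 4 * cxx"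
proof -
  have U: "U > 1" and V: "V > 0"
    using par(4) power_strict_mono[of "1/2" t 2] by (simp_all add: U_def V_def cheb_U_1[unfolded One_nat_def] cheb_U_2 power2_eq_square)
  have M: "M\<^sub>1 > 0" "M\<^sub>2 > 0" "M\<^sub>3 > 0"
    using par by (simp_all add: M\<^sub>1_def M\<^sub>2_def M\<^sub>3_def)
  have \<delta>: "\<delta> > 0"
    using par by simp
  then have b: "b\<^sub>3 > 0" "b\<^sub>4 > 0"
    by (simp_all add: b\<^sub>3_def b\<^sub>4_def add_pos_pos)
  have \<delta>2: "1 \<le> \<delta>\<^sup>2"
    using par(3) by simp
  \<comment> \<open>The difference is (8\<delta>^4 - 4\<delta>^2 + 5)/9, the polynomial that appears
    in \<open>chi1\<close> and \<open>chi2\<close>.\<close>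
  have PQ1: "4 * \<delta> * b\<^sub>4 \<le> 5 * b\<^sub>3\<^sup>2"
  proof -
    have "5 * b\<^sub>3\<^sup>2 - 4 * \<delta> * b\<^sub>4 = (8 * (\<delta>\<^sup>2)\<^sup>2 - 4 * \<delta>\<^sup>2 + 5) / 9"
      by (simp add: b\<^sub>3_def b\<^sub>4_def field_simps power2_eq_square power3_eq_cube)
    also have "8 * (\<delta>\<^sup>2)\<^sup>2 - 4 * \<delta>\<^sup>2 + 5 = 4 * (\<delta>\<^sup>2)\<^sup>2 + (2 * \<delta>\<^sup>2 - 1)\<^sup>2 + 4"
      by (simp add: power2_eq_square algebra_simps)
    finally show ?thesis
      by (smt (verit) zero_le_power2 divide_nonneg_pos)
  qed
  have PQ2: "3 * b\<^sub>3\<^sup>2 \<le> 4 * (\<delta> * b\<^sub>4)"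
  proof -
    have "4 * (\<delta> * b\<^sub>4) - 3 * b\<^sub>3\<^sup>2 = (4 * \<delta>\<^sup>2 - 1) / 3"
      by (simp add: b\<^sub>3_def b\<^sub>4_def field_simps power2_eq_square power3_eq_cube)
    then show ?thesis
      using \<delta>2 by simp
  qed
  have MM: "2 * M\<^sub>2\<^sup>2 \<le> 3 * (M\<^sub>1 * M\<^sub>3)"
  proof -
    have "3 * (M\<^sub>1 * M\<^sub>3) - 2 * M\<^sub>2\<^sup>2 = lam\<^sup>2 + 4 * (lam * \<mu>) + \<mu>\<^sup>2"
      by (simp add: M\<^sub>1_def M\<^sub>2_def M\<^sub>3_def power2_eq_square algebra_simps)
    then show ?thesis
      using par by (smt (verit) mult_nonneg_nonneg zero_le_power2)
  qed
  show "0 \<le> cx"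
  proof -
    have "cx = U ^ 3 * (5 * b\<^sub>3\<^sup>2 - 4 * \<delta> * b\<^sub>4) / (4 * \<delta> * b\<^sub>4 * b\<^sub>3\<^sup>2 * M\<^sub>1\<^sup>2 * M\<^sub>2)"
      using b M \<delta> by (simp add: cx_def field_simps)
    then show ?thesis
      using PQ1 U b M \<delta> by simp
  qed
  show "0 \<le> cy" "0 \<le> cs" "0 \<le> cxx"
    using U V b M \<delta> by (simp_all add: cy_def cs_def cxx_def)
  show "cs \<le> 4 * cxx"
  proof -
    \<comment> \<open>The comparison of \<open>cs\<close> with \<open>cxx\<close> separates into a
      factor in \<delta> and a factor in lam and \<mu>; the constants 3, 2, 4, 3 leave exactly the
      required 2.\<close>
    have "(3 * b\<^sub>3\<^sup>2) * (2 * M\<^sub>2\<^sup>2) \<le> (4 * (\<delta> * b\<^sub>4)) * (3 * (M\<^sub>1 * M\<^sub>3))"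
      using b \<delta> by (intro mult_mono[OF PQ2 MM]) simp_all
    then have le: "b\<^sub>3\<^sup>2 * M\<^sub>2\<^sup>2 \<le> 2 * \<delta> * b\<^sub>4 * M\<^sub>1 * M\<^sub>3"
      by (simp add: mult_ac)
    have "cs \<le> U\<^sup>2 / (b\<^sub>3\<^sup>2 * M\<^sub>2\<^sup>2)"
      unfolding cs_def using b M by (intro divide_left_mono le) (auto intro!: mult_pos_pos \<delta>)
    then show ?thesis
      by (simp add: cxx_def)
  qed
  have D: "D = 162 * \<delta> * b\<^sub>4 * b\<^sub>3\<^sup>2 * M\<^sub>3 * M\<^sub>2\<^sup>2 * M\<^sub>1 ^ 4"
    by (simp add: D_def b\<^sub>3_def b\<^sub>4_def M\<^sub>1_def M\<^sub>2_def M\<^sub>3_def power_divide)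
  then show Dpos: "D > 0"
    using b M \<delta> by simp
  have Q: "(2 * \<delta>\<^sup>2 + 1)\<^sup>2 = 9 * b\<^sub>3\<^sup>2" and P: "\<delta> ^ 3 + 2 * \<delta> = 3 * b\<^sub>4"
    by (simp_all add: b\<^sub>3_def b\<^sub>4_def power_divide)
  have R: "8 * \<delta> ^ 4 - 4 * \<delta>\<^sup>2 + 5 = 45 * b\<^sub>3\<^sup>2 - 36 * \<delta> * b\<^sub>4"
    by (simp add: b\<^sub>3_def b\<^sub>4_def field_simps power2_eq_square power3_eq_cube power4_eq_xxxx)
  show "9 * (cheb_U 1 t)\<^sup>2 / ((2 * \<delta>\<^sup>2 + 1)\<^sup>2 * (2 * lam + \<mu>)\<^sup>2) = 4 * cxx"
    unfolding Q by (simp add: cxx_def U_def M\<^sub>2_def)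
  have D4: "D * c\<^sub>4 = M\<^sub>2\<^sup>2 * U * Om lam \<mu> \<delta> t"
  proof -
    have "Om lam \<mu> \<delta> t = 162 * b\<^sub>3\<^sup>2 * M\<^sub>1 ^ 3 * X
        - U ^ 3 * M\<^sub>3 * (27 * b\<^sub>3\<^sup>2 * (\<mu>\<^sup>2 + 3 * \<mu> - 4) + 162 * \<delta> * b\<^sub>4)"
      by (simp add: Om_def Q P U_def X_def M\<^sub>1_def M\<^sub>3_def)
    moreover have "D * (X / (\<delta> * b\<^sub>4 * M\<^sub>1 * M\<^sub>3)) = M\<^sub>2\<^sup>2 * (162 * b\<^sub>3\<^sup>2 * M\<^sub>1 ^ 3 * X)"
      using b M \<delta> by (simp add: D field_simps power3_eq_cube power4_eq_xxxx)
    moreover have "D * (U ^ 3 * (\<mu>\<^sup>2 + 3 * \<mu> - 4) / (6 * \<delta> * b\<^sub>4 * M\<^sub>1 ^ 4))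
        = M\<^sub>2\<^sup>2 * (U ^ 3 * M\<^sub>3 * (27 * b\<^sub>3\<^sup>2 * (\<mu>\<^sup>2 + 3 * \<mu> - 4)))"
      using b M \<delta> by (simp add: D)
    moreover have "D * (U ^ 3 / (b\<^sub>3\<^sup>2 * M\<^sub>1 ^ 4)) = M\<^sub>2\<^sup>2 * (U ^ 3 * M\<^sub>3 * (162 * \<delta> * b\<^sub>4))"
      using b M \<delta> by (simp add: D)
    ultimately show ?thesis
      unfolding c\<^sub>4_def by algebra
  qed
  have "D * \<bar>c\<^sub>4\<bar> = \<bar>D * c\<^sub>4\<bar>"
    using Dpos by (simp add: abs_mult)
  then have D4': "D * \<bar>c\<^sub>4\<bar> = M\<^sub>2\<^sup>2 * U * \<bar>Om lam \<mu> \<delta> t\<bar>"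
    unfolding D4 using U by (simp add: abs_mult)
  have Dx: "D * (2 * cx) = 9 * M\<^sub>1\<^sup>2 * M\<^sub>2 * M\<^sub>3 * U ^ 3 * (45 * b\<^sub>3\<^sup>2 - 36 * \<delta> * b\<^sub>4)"
  proof -
    have "D * (2 * (U ^ 3 * (A - B))) = U ^ 3 * (2 * (D * A) - 2 * (D * B))" for A B
      by algebra
    moreover have "2 * (D * (5 / (4 * \<delta> * b\<^sub>4 * M\<^sub>1\<^sup>2 * M\<^sub>2))) = 9 * M\<^sub>1\<^sup>2 * M\<^sub>2 * M\<^sub>3 * (45 * b\<^sub>3\<^sup>2)"
      using b M \<delta> by (simp add: D field_simps power2_eq_square power4_eq_xxxx)
    moreover have "2 * (D * (1 / (b\<^sub>3\<^sup>2 * M\<^sub>1\<^sup>2 * M\<^sub>2))) = 9 * M\<^sub>1\<^sup>2 * M\<^sub>2 * M\<^sub>3 * (36 * \<delta> * b\<^sub>4)"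
      using b M \<delta> by (simp add: D field_simps power2_eq_square power4_eq_xxxx)
    ultimately have "D * (2 * cx) = U ^ 3 * (9 * M\<^sub>1\<^sup>2 * M\<^sub>2 * M\<^sub>3 * (45 * b\<^sub>3\<^sup>2) - 9 * M\<^sub>1\<^sup>2 * M\<^sub>2 * M\<^sub>3 * (36 * \<delta> * b\<^sub>4))"
      unfolding cx_def by (simp only:)
    then show ?thesis
      by (simp add: algebra_simps)
  qed
  have Dy: "D * (2 * cy) = 324 * M\<^sub>1 ^ 3 * M\<^sub>2\<^sup>2 * b\<^sub>3\<^sup>2 * U * V"
    using b M \<delta> by (simp add: D cy_def field_simps power3_eq_cube power4_eq_xxxx)
  have Ds: "D * (2 * cs) = 162 * M\<^sub>1 ^ 3 * M\<^sub>2\<^sup>2 * b\<^sub>3\<^sup>2 * U\<^sup>2"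
    using b M \<delta> by (simp add: D cs_def field_simps power3_eq_cube power4_eq_xxxx)
  have Dxx: "D * (4 * cxx) = 162 * \<delta> * b\<^sub>4 * M\<^sub>3 * M\<^sub>1 ^ 4 * U\<^sup>2"
    using b M \<delta> by (simp add: D cxx_def)
  have "D * (\<bar>c\<^sub>4\<bar> - 2 * (cx + cy + cs) + 4 * cxx)
      = D * \<bar>c\<^sub>4\<bar> - D * (2 * cx) - D * (2 * cy) - D * (2 * cs) + D * (4 * cxx)"
    by (simp add: algebra_simps)
  also have "\<dots> = chi1 lam \<mu> \<delta> t"
    unfolding D4' Dx Dy Ds Dxx chi1_def Q P R
      M\<^sub>1_def[symmetric] M\<^sub>2_def[symmetric] M\<^sub>3_def[symmetric] U_def[symmetric] V_def[symmetric]
    by algebra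
  finally show "chi1 lam \<mu> \<delta> t = D * (\<bar>c\<^sub>4\<bar> - 2 * (cx + cy + cs) + 4 * cxx)" ..
  have "D * (2 * (cx + cy + cs) - 8 * cxx)
      = D * (2 * cx) + D * (2 * cy) + D * (2 * cs) - 2 * (D * (4 * cxx))"
    by (simp add: algebra_simps)
  also have "\<dots> = 9 * chi2 lam \<mu> \<delta> t"
    unfolding Dx Dy Ds Dxx chi2_def Q P R
      M\<^sub>1_def[symmetric] M\<^sub>2_def[symmetric] M\<^sub>3_def[symmetric] U_def[symmetric] V_def[symmetric]
    by algebra
  finally show "9 * chi2 lam \<mu> \<delta> t = D * (2 * (cx + cy + cs) - 8 * cxx)" ..
qed

section \<open>The bound as a quadratic polynomial in r^2\<close>

lemma hankel_bound:
  fixes lam \<mu> \<delta> t :: real and f h :: "complex \<Rightarrow> complex"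
  assumes par: "lam \<ge> 1" "\<mu> \<ge> 0" "\<delta> \<ge> 1" "1/2 < t"
    and f: "f \<in> class_A" and h_eq: "h = hadamard_product f (f_delta \<delta>)"
    and hN: "h \<in> N_class \<mu> \<delta> lam t"
  defines "a \<equiv> taylor_coeff f"
    and "D \<equiv> 6 * \<delta> * (\<delta> ^ 3 + 2 * \<delta>) * (2 * \<delta>\<^sup>2 + 1)\<^sup>2 * (3 * lam + \<mu>) * (2 * lam + \<mu>)\<^sup>2 * (lam + \<mu>) ^ 4"
  shows "\<exists>x. 0 \<le> x \<and> x \<le> 1 \<and> norm (a 2 * a 4 - (a 3)\<^sup>2)
    \<le> 9 * (cheb_U 1 t)\<^sup>2 / ((2 * \<delta>\<^sup>2 + 1)\<^sup>2 * (2 * lam + \<mu>)\<^sup>2)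
      + (chi1 lam \<mu> \<delta> t * x\<^sup>2 + 9 * chi2 lam \<mu> \<delta> t * x) / D"
proof -
  obtain k where hb: "h \<in> bi_univalent" and k: "univalent_inverse h k"
    and subh: "subordinate (N_op \<mu> lam h) (cheb_gen t)" and subk: "subordinate (N_op \<mu> lam k) (cheb_gen t)"
    using hN by (auto simp: N_class_def)
  have hA: "h \<in> class_A" and hinj: "inj_on h unit_disc"
    using hb by (auto simp: bi_univalent_def)
  then have h: "h holomorphic_on unit_disc" "h 0 = 0" "deriv h 0 = 1"
    by (auto simp: class_A_def)
  have khol: "k holomorphic_on unit_disc" "inj_on k unit_disc"
    using k by (auto simp: univalent_inverse_def)
  have \<delta>: "\<delta> > 0"
    using par by simp
  define H where "H = fps_expansion h 0"
  have H: "h has_fps_expansion H"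
    unfolding H_def by (rule holomorphic_on_disc_has_fps_expansion[OF h(1)])
  define b\<^sub>3 b\<^sub>4 where "b\<^sub>3 = (2 * \<delta>\<^sup>2 + 1) / 3" and "b\<^sub>4 = (\<delta> ^ 3 + 2 * \<delta>) / 3"
  have "fps_nth H n = a n * taylor_coeff (f_delta \<delta>) n" for n
    using hadamard_product_coeff[OF _ f_delta_holomorphic[OF \<delta>], of f n] f
    by (simp add: H_def h_eq a_def taylor_coeff_def class_A_def)
  then have Hn: "fps_nth H 2 = a 2 * of_real \<delta>" "fps_nth H 3 = a 3 * of_real b\<^sub>3" "fps_nth H 4 = a 4 * of_real b\<^sub>4"
    using f_delta_coeffs[OF \<delta>] by (simp_all add: b\<^sub>3_def b\<^sub>4_def)
  obtain K where K: "k has_fps_expansion K" "k 0 = 0" "deriv k 0 = 1"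
    and Kn: "fps_nth K 2 = - fps_nth H 2"
    "fps_nth K 3 = 2 * (fps_nth H 2)\<^sup>2 - fps_nth H 3"
    "fps_nth K 4 = - (5 * fps_nth H 2 ^ 3 - 5 * fps_nth H 2 * fps_nth H 3 + fps_nth H 4)"
    by (rule univalent_inverse_coeffs[OF hA hinj H k])
  obtain N where N: "N_op \<mu> lam h has_fps_expansion N" "fps_nth N 0 = 1"
    "fps_nth N 1 = (of_real lam + of_real \<mu>) * fps_nth H 2"
    "fps_nth N 2 = (2 * of_real lam + of_real \<mu>) * (fps_nth H 3 + (of_real \<mu> - 1) / 2 * (fps_nth H 2)\<^sup>2)"
    "fps_nth N 3 = (3 * of_real lam + of_real \<mu>) * (fps_nth H 4 + (of_real \<mu> - 1) * fps_nth H 2 * fps_nth H 3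
       + (of_real \<mu> - 1) * (of_real \<mu> - 2) / 6 * fps_nth H 2 ^ 3)"
    by (rule N_op_coeffs[OF h(1) hinj h(2,3) H])
  obtain N' where N': "N_op \<mu> lam k has_fps_expansion N'" "fps_nth N' 0 = 1"
    "fps_nth N' 1 = (of_real lam + of_real \<mu>) * fps_nth K 2"
    "fps_nth N' 2 = (2 * of_real lam + of_real \<mu>) * (fps_nth K 3 + (of_real \<mu> - 1) / 2 * (fps_nth K 2)\<^sup>2)"
    "fps_nth N' 3 = (3 * of_real lam + of_real \<mu>) * (fps_nth K 4 + (of_real \<mu> - 1) * fps_nth K 2 * fps_nth K 3
       + (of_real \<mu> - 1) * (of_real \<mu> - 2) / 6 * fps_nth K 2 ^ 3)"
    by (rule N_op_coeffs[OF khol K(2,3,1)])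
  obtain w :: "complex \<Rightarrow> complex" and W where w: "w holomorphic_on unit_disc" "w \<in> unit_disc \<rightarrow> unit_disc" "w 0 = 0" "w has_fps_expansion W"
    and Wn: "fps_nth N 1 = cheb_U 1 t * fps_nth W 1"
    "fps_nth N 2 = cheb_U 1 t * fps_nth W 2 + cheb_U 2 t * (fps_nth W 1)\<^sup>2"
    "fps_nth N 3 = cheb_U 1 t * fps_nth W 3 + 2 * of_real (cheb_U 2 t) * fps_nth W 1 * fps_nth W 2
       + cheb_U 3 t * fps_nth W 1 ^ 3"
    by (rule subordinate_cheb_gen_coeffs[OF subh N(1)])
  obtain v :: "complex \<Rightarrow> complex" and V where v: "v holomorphic_on unit_disc" "v \<in> unit_disc \<rightarrow> unit_disc" "v 0 = 0" "v has_fps_expansion V"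
    and Vn: "fps_nth N' 1 = cheb_U 1 t * fps_nth V 1"
    "fps_nth N' 2 = cheb_U 1 t * fps_nth V 2 + cheb_U 2 t * (fps_nth V 1)\<^sup>2"
    "fps_nth N' 3 = cheb_U 1 t * fps_nth V 3 + 2 * of_real (cheb_U 2 t) * fps_nth V 1 * fps_nth V 2
       + cheb_U 3 t * fps_nth V 1 ^ 3"
    by (rule subordinate_cheb_gen_coeffs[OF subk N'(1)])
  have "complex_of_real (cheb_U 1 t) * fps_nth V 1 = complex_of_real (cheb_U 1 t) * - fps_nth W 1"
    using Wn(1) Vn(1) unfolding N N' Kn by simp
  moreover have "complex_of_real (cheb_U 1 t) \<noteq> 0"
    using par by (simp add: cheb_U_1[unfolded One_nat_def])
  ultimately have V1: "fps_nth V 1 = - fps_nth W 1"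
    by (simp only: mult_cancel_left) simp

  define U where "U = cheb_U 1 t"
  define c\<^sub>4 where "c\<^sub>4 = U * (cheb_U 3 t / (\<delta> * b\<^sub>4 * (lam + \<mu>) * (3 * lam + \<mu>))
    - U ^ 3 * (\<mu>\<^sup>2 + 3 * \<mu> - 4) / (6 * \<delta> * b\<^sub>4 * (lam + \<mu>) ^ 4) - U ^ 3 / (b\<^sub>3\<^sup>2 * (lam + \<mu>) ^ 4))"
  define cx where "cx = U ^ 3 * (5 / (4 * \<delta> * b\<^sub>4 * (lam + \<mu>)\<^sup>2 * (2 * lam + \<mu>)) - 1 / (b\<^sub>3\<^sup>2 * (lam + \<mu>)\<^sup>2 * (2 * lam + \<mu>)))"
  define cy where "cy = U * cheb_U 2 t / (\<delta> * b\<^sub>4 * (lam + \<mu>) * (3 * lam + \<mu>))"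
  define cs where "cs = U\<^sup>2 / (2 * \<delta> * b\<^sub>4 * (lam + \<mu>) * (3 * lam + \<mu>))"
  define cxx where "cxx = U\<^sup>2 / (4 * b\<^sub>3\<^sup>2 * (2 * lam + \<mu>)\<^sup>2)"
  note wt = hankel_weights[OF par, folded b\<^sub>3_def b\<^sub>4_def U_def D_def, folded c\<^sub>4_def cx_def cy_def cs_def cxx_def]

  define d\<^sub>1 where "d\<^sub>1 = fps_nth W 1"
  define x where "x = fps_nth W 2 - fps_nth V 2"
  define y where "y = fps_nth W 2 + fps_nth V 2"
  define s where "s = fps_nth W 3 - fps_nth V 3"
  have nz: "complex_of_real lam + of_real \<mu> \<noteq> 0" "2 * complex_of_real lam + of_real \<mu> \<noteq> 0"
    "3 * complex_of_real lam + of_real \<mu> \<noteq> 0" "complex_of_real \<delta> \<noteq> 0"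
    "complex_of_real b\<^sub>3 \<noteq> 0" "complex_of_real b\<^sub>4 \<noteq> 0"
  proof -
    have "b\<^sub>3 > 0" "b\<^sub>4 > 0"
      using \<delta> by (simp_all add: b\<^sub>3_def b\<^sub>4_def add_pos_pos)
    then have "complex_of_real (lam + \<mu>) \<noteq> 0" "complex_of_real (2 * lam + \<mu>) \<noteq> 0"
      "complex_of_real (3 * lam + \<mu>) \<noteq> 0" "complex_of_real \<delta> \<noteq> 0"
      "complex_of_real b\<^sub>3 \<noteq> 0" "complex_of_real b\<^sub>4 \<noteq> 0"
      unfolding of_real_eq_0_iff using par by linarith+
    then show "complex_of_real lam + of_real \<mu> \<noteq> 0" "2 * complex_of_real lam + of_real \<mu> \<noteq> 0"
      "3 * complex_of_real lam + of_real \<mu> \<noteq> 0" "complex_of_real \<delta> \<noteq> 0"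
      "complex_of_real b\<^sub>3 \<noteq> 0" "complex_of_real b\<^sub>4 \<noteq> 0"
      unfolding of_real_add of_real_mult of_real_numeral by blast+
  qed
  have hk: "a 2 * a 4 - (a 3)\<^sup>2 = of_real c\<^sub>4 * d\<^sub>1 ^ 4 + of_real cx * (d\<^sub>1\<^sup>2 * x) + of_real cy * (d\<^sub>1\<^sup>2 * y)
      + of_real cs * (d\<^sub>1 * s) - of_real cxx * x\<^sup>2"
    using hankel_identity[OF nz Wn(1)[unfolded N Hn] Wn(2)[unfolded N Hn] Wn(3)[unfolded N Hn]
      Vn(2)[unfolded N' Kn V1 Hn] Vn(3)[unfolded N' Kn V1 Hn]]
    unfolding c\<^sub>4_def cx_def cy_def cs_def cxx_def d\<^sub>1_def x_def y_def s_def U_def by simp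

  define r where "r = norm d\<^sub>1"
  have r: "0 \<le> r" "r \<le> 1"
    using Schwarz_coeff_1[OF w] by (simp_all add: r_def d\<^sub>1_def)
  obtain p where p: "0 \<le> p" "p \<le> 1" "norm (fps_nth W 2) = (1 - r\<^sup>2) * p"
    "norm (fps_nth W 3) \<le> (1 - r\<^sup>2) * (1 - p\<^sup>2 + r * p\<^sup>2)"
    unfolding r_def d\<^sub>1_def by (rule Schwarz_coeff_3[OF w])
  \<comment> \<open>Opposite first coefficients have the same modulus, so a single r governs both
    Schwarz functions.\<close>
  have rV: "norm (fps_nth V 1) = r"
    by (simp add: V1[unfolded One_nat_def] r_def d\<^sub>1_def)
  obtain q where q: "0 \<le> q" "q \<le> 1" "norm (fps_nth V 2) = (1 - r\<^sup>2) * q"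
    "norm (fps_nth V 3) \<le> (1 - r\<^sup>2) * (1 - q\<^sup>2 + r * q\<^sup>2)"
    by (rule Schwarz_coeff_3[OF v, unfolded rV])
  have nx: "norm x \<le> (1 - r\<^sup>2) * (p + q)"
    unfolding x_def using norm_triangle_ineq4[of "fps_nth W 2" "fps_nth V 2"] p q by (simp add: distrib_left)
  have ny: "norm y \<le> (1 - r\<^sup>2) * (p + q)"
    unfolding y_def using norm_triangle_ineq[of "fps_nth W 2" "fps_nth V 2"] p q by (simp add: distrib_left)
  have ns: "norm s \<le> (1 - r\<^sup>2) * (1 - p\<^sup>2 + r * p\<^sup>2) + (1 - r\<^sup>2) * (1 - q\<^sup>2 + r * q\<^sup>2)"
    unfolding s_def using norm_triangle_ineq4[of "fps_nth W 3" "fps_nth V 3"] p q by linarith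
  have "norm (a 2 * a 4 - (a 3)\<^sup>2) \<le> norm (of_real c\<^sub>4 * d\<^sub>1 ^ 4) + norm (of_real cx * (d\<^sub>1\<^sup>2 * x))
      + norm (of_real cy * (d\<^sub>1\<^sup>2 * y)) + norm (of_real cs * (d\<^sub>1 * s)) + norm (of_real cxx * x\<^sup>2)"
    unfolding hk by (intro order_trans[OF norm_triangle_ineq4] add_right_mono order_trans[OF norm_triangle_ineq] order_refl)
  also have "\<dots> = \<bar>c\<^sub>4\<bar> * r ^ 4 + cx * (r\<^sup>2 * norm x) + cy * (r\<^sup>2 * norm y) + cs * (r * norm s) + cxx * (norm x)\<^sup>2"
    using wt(1-4) by (simp add: norm_mult norm_power r_def)
  also have "\<dots> \<le> \<bar>c\<^sub>4\<bar> * r ^ 4 + cx * (r\<^sup>2 * ((1 - r\<^sup>2) * (p + q))) + cy * (r\<^sup>2 * ((1 - r\<^sup>2) * (p + q)))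
      + cs * (r * ((1 - r\<^sup>2) * (1 - p\<^sup>2 + r * p\<^sup>2) + (1 - r\<^sup>2) * (1 - q\<^sup>2 + r * q\<^sup>2)))
      + cxx * ((1 - r\<^sup>2) * (p + q))\<^sup>2"
    using wt(1-4) r nx ny ns by (intro add_mono mult_left_mono power_mono order_refl) auto
  \<comment> \<open>The sum and the difference of d_2 and e_2 have the same majorant, so their
    weights act as the single weight cx + cy.\<close>
  also have "\<dots> \<le> \<bar>c\<^sub>4\<bar> * r ^ 4 + (2 * (cx + cy + cs) * (r\<^sup>2 * (1 - r\<^sup>2)) + 4 * cxx * (1 - r\<^sup>2)\<^sup>2)"
    using hankel_max_at_one[OF r p(1,2) q(1,2), of "cx + cy" cs cxx] wt(1-5) by (simp add: algebra_simps)
  also have "\<dots> = 4 * cxx + ((D * (\<bar>c\<^sub>4\<bar> - 2 * (cx + cy + cs) + 4 * cxx)) * (r\<^sup>2)\<^sup>2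
      + D * (2 * (cx + cy + cs) - 8 * cxx) * r\<^sup>2) / D"
  proof -
    have cancel: "((D * A) * (r\<^sup>2)\<^sup>2 + D * B * r\<^sup>2) / D = A * (r\<^sup>2)\<^sup>2 + B * r\<^sup>2" for A B
      using wt(6) by (simp add: field_simps)
    show ?thesis
      unfolding cancel by (simp add: algebra_simps power2_eq_square power4_eq_xxxx)
  qed
  also have "\<dots> = 9 * (cheb_U 1 t)\<^sup>2 / ((2 * \<delta>\<^sup>2 + 1)\<^sup>2 * (2 * lam + \<mu>)\<^sup>2)
      + (chi1 lam \<mu> \<delta> t * (r\<^sup>2)\<^sup>2 + 9 * chi2 lam \<mu> \<delta> t * r\<^sup>2) / D"
    unfolding U_def[symmetric] wt(7-9) ..
  finally show ?thesis
    using r by (intro exI[of _ "r\<^sup>2"] conjI) (simp_all add: power_le_one)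
qed

theorem theorem1:
  fixes lam \<mu> \<delta> t :: real and f h :: "complex \<Rightarrow> complex" and a :: "nat \<Rightarrow> complex"
  assumes "lam \<ge> 1" and "\<mu> \<ge> 0" and "\<delta> \<ge> 1" and "1/2 < t" and "t \<le> 1"
    and "f \<in> class_A"
    and "\<And>n. a n = taylor_coeff f n"
    and "h = hadamard_product f (f_delta \<delta>)"
    and "h \<in> bi_univalent"
    and "h \<in> N_class \<mu> \<delta> lam t"
  shows "(chi1 lam \<mu> \<delta> t \<ge> 0 \<and> chi2 lam \<mu> \<delta> t \<ge> 0 \<longrightarrow>
            norm (a 2 * a 4 - (a 3)\<^sup>2) \<le> phi_2 lam \<mu> \<delta> t)
       \<and> (chi1 lam \<mu> \<delta> t \<le> 0 \<and> chi2 lam \<mu> \<delta> t \<le> 0 \<longrightarrow>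
            norm (a 2 * a 4 - (a 3)\<^sup>2) \<le> 36 * t\<^sup>2 / ((2 * \<delta>\<^sup>2 + 1)\<^sup>2 * (2 * lam + \<mu>)\<^sup>2))
       \<and> (chi1 lam \<mu> \<delta> t > 0 \<and> chi2 lam \<mu> \<delta> t < 0 \<longrightarrow>
            norm (a 2 * a 4 - (a 3)\<^sup>2)
              \<le> max (36 * t\<^sup>2 / ((2 * \<delta>\<^sup>2 + 1)\<^sup>2 * (2 * lam + \<mu>)\<^sup>2)) (phi_2 lam \<mu> \<delta> t))
       \<and> (chi1 lam \<mu> \<delta> t < 0 \<and> chi2 lam \<mu> \<delta> t > 0 \<longrightarrow>
            norm (a 2 * a 4 - (a 3)\<^sup>2) \<le> max (phi_c0 lam \<mu> \<delta> t) (phi_2 lam \<mu> \<delta> t))"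
proof -
  let ?n = "norm (a 2 * a 4 - (a 3)\<^sup>2)" and ?c1 = "chi1 lam \<mu> \<delta> t" and ?c2 = "chi2 lam \<mu> \<delta> t"
  define K where "K = 9 * (cheb_U 1 t)\<^sup>2 / ((2 * \<delta>\<^sup>2 + 1)\<^sup>2 * (2 * lam + \<mu>)\<^sup>2)"
  define D where "D = 6 * \<delta> * (\<delta> ^ 3 + 2 * \<delta>) * (2 * \<delta>\<^sup>2 + 1)\<^sup>2 * (3 * lam + \<mu>) * (2 * lam + \<mu>)\<^sup>2 * (lam + \<mu>) ^ 4"
  obtain x where x: "0 \<le> x" "x \<le> 1" and le: "?n \<le> K + (?c1 * x\<^sup>2 + 9 * ?c2 * x) / D"
    using hankel_bound[OF assms(1-4,6,8,10)] unfolding assms(7) K_def D_def by blast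
  have D: "D > 0"
    unfolding D_def using hankel_weights(6)[OF assms(1-4)] .
  have K: "36 * t\<^sup>2 / ((2 * \<delta>\<^sup>2 + 1)\<^sup>2 * (2 * lam + \<mu>)\<^sup>2) = K"
    by (simp add: K_def cheb_U_1[unfolded One_nat_def] power_mult_distrib)
  have phi2: "phi_2 lam \<mu> \<delta> t = K + (?c1 + 9 * ?c2) / D"
    by (simp add: phi_2_def K_def D_def)
  have phic: "phi_c0 lam \<mu> \<delta> t = K - 81 * ?c2\<^sup>2 / (4 * ?c1 * D)"
  proof -
    \<comment> \<open>E stands for the denominator factors of \<open>phi_c0\<close> without the 6
      that D contains, and 27/8 = 81/(4 * 6).\<close>
    have "27 * ?c2\<^sup>2 / (8 * ?c1 * E) = 81 * ?c2\<^sup>2 / (4 * ?c1 * (6 * E))" for E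
      using mult_divide_mult_cancel_left[of 3 "27 * ?c2\<^sup>2" "8 * ?c1 * E"] by (simp add: mult_ac)
    then show ?thesis
      by (simp add: phi_c0_def K_def D_def mult.assoc)
  qed
  note q = quadratic_bound_cases[OF D x, where c\<^sub>1 = ?c1 and c\<^sub>2 = ?c2 and K = K]
  show ?thesis
    unfolding K phi2 phic
    \<comment> \<open>In the last case the vertex value is the first argument of the
      maximum.\<close>
    using order_trans[OF le q(1)] order_trans[OF le q(2)] order_trans[OF le q(3)] order_trans[OF le q(4)]
    by (auto intro: max.coboundedI1)
qed

end
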